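(* Let $\mathscr{H}_1,\mathscr{H}_2$ be Hilbert spaces, let $X\in\mathbb{B}(\mathscr{H}_2,\mathscr{H}_1)$ and $Y\in\mathbb{B}(\mathscr{H}_1,\mathscr{H}_2)$, and let $T=\begin{bmatrix}0&X\\ Y&0\end{bmatrix}\in\mathbb{B}(\mathscr{H}_1\oplus\mathscr{H}_2)$. Let $r\ge 1$ and let $f,g$ be nonnegative continuous functions on $[0,\infty)$ satisfying $f(t)g(t)=t$ for all $t\in[0,\infty)$. Then $$\omega^{r}(T)\leq 2^{r-2}\left\|f^{2r}(|X|)+g^{2r}(|Y^*|)\right\|^{\frac12}\left\|f^{2r}(|Y|)+g^{2r}(|X^*|)\right\|^{\frac12}$$ and $$\omega^{r}(T)\leq 2^{r-2}\left\|f^{2r}(|X|)+f^{2r}(|Y^*|)\right\|^{\frac12}\left\|g^{2r}(|Y|)+g^{2r}(|X^*|)\right\|^{\frac12}.$$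
   Context: Hilbert spaces are complex. $\mathbb{B}(\mathscr{K},\mathscr{L})$ is the space of bounded linear operators from $\mathscr{K}$ to $\mathscr{L}$, and $\mathbb{B}(\mathscr{K})=\mathbb{B}(\mathscr{K},\mathscr{K})$. The numerical radius of $T\in\mathbb{B}(\mathscr{K})$ is $\omega(T)=\sup\{|\langle Tx,x\rangle| : x\in\mathscr{K},\ \|x\|=1\}$, and $\omega^{r}(T)=(\omega(T))^r$. $|A|=(A^*A)^{1/2}$ is the absolute value of an operator $A$. $f^{2r}(A)$ denotes $h(A)$, with $h(t)=f(t)^{2r}$, in the continuous functional calculus of the positive operator $A$ (similarly $g^{2r}$). $\|\cdot\|$ is the operator norm. Operators on the direct sum are written as $2\times2$ operator matrices, so $T(x_1,x_2)=(Xx_2,Yx_1)$. *)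

theory Defs
  imports "HOL-Analysis.Analysis" "HOL-Library.Nonpos_Ints"
    "HOL-Computational_Algebra.Polynomial"
begin

section \<open>Complex Hilbert spaces\<close>

text \<open>A complex inner product space is a real inner product space whose scalar multiplication
  is the restriction of a complex one and whose inner product is the real part of a complex one;
  norm and topology are thus those of the library. The complex inner product is linear in its
  first argument.\<close>

class complex_inner = real_inner +
  fixes scaleC :: "complex \<Rightarrow> 'a \<Rightarrow> 'a" (infixr "*\<^sub>C" 75)
    and cinner :: "'a \<Rightarrow> 'a \<Rightarrow> complex"
  assumes scaleC_add_right: "c *\<^sub>C (x + y) = c *\<^sub>C x + c *\<^sub>C y"
    and scaleC_add_left: "(c + d) *\<^sub>C x = c *\<^sub>C x + d *\<^sub>C x"
    and scaleC_scaleC: "c *\<^sub>C d *\<^sub>C x = (c * d) *\<^sub>C x"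
    and scaleR_scaleC: "s *\<^sub>R x = complex_of_real s *\<^sub>C x"
    and cinner_commute: "cinner x y = cnj (cinner y x)"
    and cinner_add_left: "cinner (x + y) z = cinner x z + cinner y z"
    and cinner_scaleC_left: "cinner (c *\<^sub>C x) y = c * cinner x y"
    and inner_Re_cinner: "inner x y = Re (cinner x y)"

class chilbert_space = complex_inner + complete_space

subclass (in chilbert_space) banach ..

instantiation complex :: chilbert_space
begin

definition scaleC_complex :: "complex \<Rightarrow> complex \<Rightarrow> complex" where
  "scaleC_complex c z = c * z"

definition cinner_complex :: "complex \<Rightarrow> complex \<Rightarrow> complex" where
  "cinner_complex z w = z * cnj w"

instance
  by standard
    (auto simp: scaleC_complex_def cinner_complex_def inner_complex_def scaleR_conv_of_real
      algebra_simps)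

end

text \<open>The Hilbert space direct sum. The library inner product on pairs is the sum of the
  inner products of the components.\<close>

instantiation prod :: (complex_inner, complex_inner) complex_inner
begin

definition scaleC_prod :: "complex \<Rightarrow> 'a \<times> 'b \<Rightarrow> 'a \<times> 'b" where
  "scaleC_prod c x = (c *\<^sub>C fst x, c *\<^sub>C snd x)"

definition cinner_prod :: "'a \<times> 'b \<Rightarrow> 'a \<times> 'b \<Rightarrow> complex" where
  "cinner_prod x y = cinner (fst x) (fst y) + cinner (snd x) (snd y)"

instance
proof
  fix c d :: complex and s :: real and x y z :: "'a \<times> 'b"
  show "c *\<^sub>C (x + y) = c *\<^sub>C x + c *\<^sub>C y"
    by (simp add: scaleC_prod_def scaleC_add_right)
  show "(c + d) *\<^sub>C x = c *\<^sub>C x + d *\<^sub>C x"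
    by (simp add: scaleC_prod_def scaleC_add_left)
  show "c *\<^sub>C d *\<^sub>C x = (c * d) *\<^sub>C x"
    by (simp add: scaleC_prod_def scaleC_scaleC)
  show "s *\<^sub>R x = complex_of_real s *\<^sub>C x"
    by (simp add: scaleC_prod_def scaleR_prod_def scaleR_scaleC)
  show "cinner x y = cnj (cinner y x)"
    by (simp add: cinner_prod_def cinner_commute[symmetric])
  show "cinner (x + y) z = cinner x z + cinner y z"
    by (simp add: cinner_prod_def cinner_add_left)
  show "cinner (c *\<^sub>C x) y = c * cinner x y"
    by (simp add: cinner_prod_def scaleC_prod_def cinner_scaleC_left distrib_left)
  show "inner x y = Re (cinner x y)"
    by (simp add: cinner_prod_def inner_prod_def inner_Re_cinner)
qed

end

instance prod :: (chilbert_space, chilbert_space) chilbert_space ..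

lemma cinner_scaleC_right:
  fixes x y :: "'a::complex_inner"
  shows "cinner x (c *\<^sub>C y) = cnj c * cinner x y"
  by (metis cinner_commute cinner_scaleC_left complex_cnj_mult)

lemma norm_scaleC:
  fixes x :: "'a::complex_inner"
  shows "norm (c *\<^sub>C x) = cmod c * norm x"
proof -
  have "inner (c *\<^sub>C x) (c *\<^sub>C x) = Re (of_real ((cmod c)\<^sup>2) * cinner x x)"
    by (simp only: inner_Re_cinner cinner_scaleC_left cinner_scaleC_right complex_norm_square
        mult.assoc mult.left_commute)
  also have "\<dots> = (cmod c)\<^sup>2 * inner x x"
    by (simp add: inner_Re_cinner)
  finally show ?thesis
    by (simp add: norm_eq_sqrt_inner real_sqrt_mult)
qed

section \<open>Bounded complex-linear operators\<close>

text \<open>Operators are elements of the library type of bounded real-linear maps, whose norm is the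
  operator norm; \<open>clinear_op A\<close> says that \<open>A\<close> is complex-linear.\<close>

definition clinear_op :: "('a::complex_inner \<Rightarrow>\<^sub>L 'b::complex_inner) \<Rightarrow> bool" where
  "clinear_op A \<longleftrightarrow> (\<forall>c x. blinfun_apply A (c *\<^sub>C x) = c *\<^sub>C blinfun_apply A x)"

text \<open>The operator matrix with rows \<open>A B\<close> and \<open>C D\<close> on the direct sum.\<close>

definition block_op ::
  "('a::real_normed_vector \<Rightarrow>\<^sub>L 'c::real_normed_vector) \<Rightarrow> ('b::real_normed_vector \<Rightarrow>\<^sub>L 'c) \<Rightarrow>
   ('a \<Rightarrow>\<^sub>L 'd::real_normed_vector) \<Rightarrow> ('b \<Rightarrow>\<^sub>L 'd) \<Rightarrow> (('a \<times> 'b) \<Rightarrow>\<^sub>L ('c \<times> 'd))" where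
  "block_op A B C D = Blinfun (\<lambda>(x, y).
     (blinfun_apply A x + blinfun_apply B y, blinfun_apply C x + blinfun_apply D y))"

lemma block_op_apply:
  "blinfun_apply (block_op A B C D) (x, y) =
    (blinfun_apply A x + blinfun_apply B y, blinfun_apply C x + blinfun_apply D y)"
proof -
  have "bounded_linear (\<lambda>z. (blinfun_apply A (fst z) + blinfun_apply B (snd z),
      blinfun_apply C (fst z) + blinfun_apply D (snd z)))"
    by (intro bounded_linear_Pair bounded_linear_add blinfun.bounded_linear_right
        bounded_linear_compose[OF blinfun.bounded_linear_right] bounded_linear_fst
        bounded_linear_snd)
  then show ?thesis
    by (simp add: block_op_def case_prod_unfold bounded_linear_Blinfun_apply)
qed

text \<open>The element \<open>0\<close> makes the supremum well defined (and equal to \<open>0\<close>) on the zero space, where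
  there are no unit vectors; otherwise it does not change the supremum.\<close>

definition numerical_radius :: "('a::complex_inner \<Rightarrow>\<^sub>L 'a) \<Rightarrow> real" where
  "numerical_radius T = Sup (insert 0 {cmod (cinner (blinfun_apply T x) x) |x. norm x = 1})"

definition cadjoint :: "('a::complex_inner \<Rightarrow>\<^sub>L 'b::complex_inner) \<Rightarrow> ('b \<Rightarrow>\<^sub>L 'a)" where
  "cadjoint A =
    (THE B. \<forall>x y. cinner (blinfun_apply A x) y = cinner x (blinfun_apply B y))"

definition positive_op :: "('a::complex_inner \<Rightarrow>\<^sub>L 'a) \<Rightarrow> bool" where
  "positive_op A \<longleftrightarrow> clinear_op A \<and> (\<forall>x. cinner (blinfun_apply A x) x \<in> \<real>\<^sub>\<ge>\<^sub>0)"

definition sqrt_op :: "('a::complex_inner \<Rightarrow>\<^sub>L 'a) \<Rightarrow> ('a \<Rightarrow>\<^sub>L 'a)" where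
  "sqrt_op A = (THE S. positive_op S \<and> S o\<^sub>L S = A)"

definition abs_op :: "('a::complex_inner \<Rightarrow>\<^sub>L 'b::complex_inner) \<Rightarrow> ('a \<Rightarrow>\<^sub>L 'a)" where
  "abs_op A = sqrt_op (cadjoint A o\<^sub>L A)"

section \<open>Continuous functional calculus\<close>

lift_definition scalar_op :: "complex \<Rightarrow> ('a::complex_inner \<Rightarrow>\<^sub>L 'a)" is "\<lambda>c x. c *\<^sub>C x"
proof (rule bounded_linear_intro)
  fix c :: complex and s :: real and x y :: 'a
  show "c *\<^sub>C (x + y) = c *\<^sub>C x + c *\<^sub>C y"
    by (rule scaleC_add_right)
  show "c *\<^sub>C s *\<^sub>R x = s *\<^sub>R c *\<^sub>C x"
    by (simp add: scaleR_scaleC scaleC_scaleC mult.commute)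
  show "norm (c *\<^sub>C x) \<le> norm x * cmod c"
    by (simp add: norm_scaleC mult.commute)
qed

text \<open>For complex-linear \<open>A\<close> the inverse \<open>B\<close> below is automatically complex-linear.\<close>

definition op_spectrum :: "('a::complex_inner \<Rightarrow>\<^sub>L 'a) \<Rightarrow> complex set" where
  "op_spectrum A =
    {z. \<not> (\<exists>B. B o\<^sub>L (A - scalar_op z) = id_blinfun \<and> (A - scalar_op z) o\<^sub>L B = id_blinfun)}"

definition poly_op :: "real poly \<Rightarrow> ('a::complex_inner \<Rightarrow>\<^sub>L 'a) \<Rightarrow> ('a \<Rightarrow>\<^sub>L 'a)" where
  "poly_op p A = (\<Sum>i\<le>degree p. coeff p i *\<^sub>R (((o\<^sub>L) A) ^^ i) id_blinfun)"

text \<open>The continuous functional calculus \<open>h(A)\<close> of a self-adjoint operator \<open>A\<close> for real-valued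
  \<open>h\<close> continuous on the spectrum, which is then a compact subset of the reals: the operator norm
  limit of \<open>p\<^sub>n(A)\<close> for any real polynomials \<open>p\<^sub>n\<close> that converge to \<open>h\<close> uniformly on the spectrum.
  Such polynomials exist by the Weierstrass theorem, so the limit is unique.\<close>

definition cfc :: "(real \<Rightarrow> real) \<Rightarrow> ('a::complex_inner \<Rightarrow>\<^sub>L 'a) \<Rightarrow> ('a \<Rightarrow>\<^sub>L 'a)" where
  "cfc h A = (THE B. \<forall>p :: nat \<Rightarrow> real poly.
     uniform_limit {t. complex_of_real t \<in> op_spectrum A} (\<lambda>n. poly (p n)) h sequentially
       \<longrightarrow> (\<lambda>n. poly_op (p n) A) \<longlonglongrightarrow> B)"

end

theory Submission
  imports Defs "HOL-Computational_Algebra.Fundamental_Theorem_Algebra"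
begin

text \<open>For a unit vector \<open>(u, v)\<close> the quadratic form of the operator matrix is
  \<open>\<langle>X v, u\<rangle> + \<langle>Y u, v\<rangle>\<close>. Two inequalities control each summand. The mixed Schwarz inequality
  (\<open>mixed_schwarz\<close>) says \<open>|\<langle>T x, y\<rangle>| \<le> \<parallel>f(|T|) x\<parallel> \<parallel>g(|T\<^sup>*|) y\<parallel>\<close>, and the inequality of Hoelder and
  McCarthy (\<open>hoelder_mccarthy\<close>) says \<open>\<langle>A x, x\<rangle>\<^sup>r \<le> \<parallel>x\<parallel>\<^bsup>2(r-1)\<^esup> \<langle>A\<^sup>r x, x\<rangle>\<close> for positive \<open>A\<close>. With
  \<open>A = f\<^sup>2(|X|)\<close> and its companions they give, for \<open>m = \<parallel>u\<parallel> \<parallel>v\<parallel>\<close>,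
  \<open>|\<langle>X v, u\<rangle>|\<^sup>r \<le> m\<^bsup>r-1\<^esup> \<langle>f\<^bsup>2r\<^esup>(|X|) v, v\<rangle>\<^bsup>1/2\<^esup> \<langle>g\<^bsup>2r\<^esup>(|X\<^sup>*|) u, u\<rangle>\<^bsup>1/2\<^esup>\<close>
  and a like bound for \<open>Y\<close>. The convexity of \<open>t\<^sup>r\<close> combines the two summands at the cost of a factor
  \<open>2\<^bsup>r-1\<^esup>\<close>, and the Cauchy--Schwarz inequality in the plane groups the terms in \<open>v\<close> and the terms in
  \<open>u\<close>, which produces the two operator norms and one more factor \<open>m\<close>. Finally \<open>m \<le> 1/2\<close>, so the total
  constant is \<open>2\<^bsup>r-1\<^esup> 2\<^bsup>-r\<^esup> = 1/2 \<le> 2\<^bsup>r-2\<^esup>\<close>. Exchanging the roles of \<open>f\<close> and \<open>g\<close> for \<open>Y\<close> changes the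
  grouping and gives the second inequality.

  The rest is the operator theory that gives these formulas a meaning. Adjoints come from the
  Riesz representation theorem. The functional calculus of a positive operator rests on
  \<open>\<parallel>p(A)\<parallel> \<le> sup |p|\<close>, the supremum being taken over the spectrum (\<open>norm_poly_op_le\<close>): for \<open>B = p(A)\<close>
  the operator \<open>\<parallel>B\<parallel>\<^sup>2 - B\<^sup>2\<close> is not bounded below, while a nonzero real polynomial without zeros on the
  spectrum is bounded below at \<open>A\<close>, by its factorization into linear and quadratic factors. The
  calculus is multiplicative, monotone and compatible with intertwining operators
  (\<open>cfc_mult\<close>, \<open>inner_cfc_mono\<close>, \<open>cfc_intertwine\<close>). The last property yields
  \<open>T h(|T|) = h(|T\<^sup>*|) T\<close>, from which the mixed Schwarz inequality follows without a polar
  decomposition.\<close>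

section \<open>Complex inner products and adjoints\<close>

lemma Im_cinner: "Im (cinner x y) = inner x (\<i> *\<^sub>C y)"
  for x y :: "'a::complex_inner"
  by (simp add: inner_Re_cinner cinner_scaleC_right)

lemma cinner_eqI:
  fixes x y :: "'a::complex_inner" and u v :: "'b::complex_inner"
  assumes "inner x y = inner u v" and "inner x (\<i> *\<^sub>C y) = inner u (\<i> *\<^sub>C v)"
  shows "cinner x y = cinner u v"
  using assms by (intro complex_eqI) (simp_all add: inner_Re_cinner[symmetric] Im_cinner)

lemma scaleC_minus_one: "- x = (-1) *\<^sub>C x" for x :: "'a::complex_inner"
  using scaleR_scaleC[of "-1" x] by simp

lemma scaleC_ii_ii: "\<i> *\<^sub>C \<i> *\<^sub>C x = - x" for x :: "'a::complex_inner"
  by (simp add: scaleC_scaleC flip: scaleC_minus_one)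

lemma inner_scaleC_ii: "inner (\<i> *\<^sub>C x) (\<i> *\<^sub>C y) = inner x y"
  for x y :: "'a::complex_inner"
  by (simp add: inner_Re_cinner cinner_scaleC_left cinner_scaleC_right)

text \<open>The real Cauchy--Schwarz inequality, after \<open>y\<close> has been rotated by the phase of
  \<open>\<langle>x, y\<rangle>\<close>, which makes the complex inner product real and nonnegative.\<close>

lemma cmod_cinner_le: "cmod (cinner x y) \<le> norm x * norm y"
  for x y :: "'a::complex_inner"
proof -
  define u where "u = sgn (cinner x y)"
  have "cnj u * cinner x y = (cinner x y * cnj (cinner x y)) / complex_of_real (cmod (cinner x y))"
    by (simp add: u_def sgn_eq)
  also have "\<dots> = complex_of_real (cmod (cinner x y))"
    by (simp only: complex_norm_square[symmetric]) (simp add: power2_eq_square)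
  finally have "cmod (cinner x y) = Re (cnj u * cinner x y)"
    by simp
  also have "\<dots> = inner x (u *\<^sub>C y)"
    by (simp add: inner_Re_cinner cinner_scaleC_right)
  also have "\<dots> \<le> norm x * (cmod u * norm y)"
    using norm_cauchy_schwarz[of x "u *\<^sub>C y"] by (simp add: norm_scaleC)
  also have "\<dots> \<le> norm x * norm y"
    by (intro mult_left_mono mult_left_le_one_le) (auto simp: u_def norm_sgn)
  finally show ?thesis .
qed

text \<open>The representing vector minimizes \<open>\<parallel>x\<parallel>\<^sup>2 - 2 \<phi> x\<close>: a minimizing sequence is Cauchy by the
  parallelogram law, and the first-order condition at its limit is the claimed identity.\<close>

theorem riesz_representation:
  fixes \<phi> :: "'a::{real_inner,complete_space} \<Rightarrow> real"
  assumes "bounded_linear \<phi>"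
  shows "\<exists>z. \<forall>x. \<phi> x = inner z x"
proof -
  interpret bounded_linear \<phi> by fact
  define J where "J x = (norm x)\<^sup>2 - 2 * \<phi> x" for x
  obtain K where K: "\<And>x. \<bar>\<phi> x\<bar> \<le> norm x * K"
    using bounded by auto
  have "- K\<^sup>2 \<le> J x" for x
  proof -
    have "0 \<le> (norm x - K)\<^sup>2" by simp
    with K[of x] show ?thesis
      by (simp add: J_def power2_diff)
  qed
  then have bdd: "bdd_below (range J)"
    by (intro bdd_belowI[of _ "- K\<^sup>2"]) auto
  define m where "m = Inf (range J)"
  have m_le: "m \<le> J x" for x
    unfolding m_def using bdd by (intro cInf_lower) auto
  have "\<exists>x. J x < m + 1 / real (Suc n)" for n
    using cInf_less_iff[OF _ bdd, of "m + 1 / real (Suc n)"] by (auto simp: m_def)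
  then obtain s where s: "\<And>n. J (s n) < m + 1 / real (Suc n)"
    by metis
  have parallelogram: "(norm (x - y))\<^sup>2 \<le> 2 * (J x - m) + 2 * (J y - m)" for x y
  proof -
    have "(norm (x - y))\<^sup>2 = 2 * J x + 2 * J y - 4 * J ((1/2) *\<^sub>R (x + y))"
      by (simp add: J_def power2_norm_eq_inner scaleR add inner_simps inner_commute
          algebra_simps)
    with m_le[of "(1/2) *\<^sub>R (x + y)"] show ?thesis by simp
  qed
  have "Cauchy s"
  proof (rule metric_CauchyI)
    fix e :: real assume "e > 0"
    obtain N where N: "4 / e\<^sup>2 < real N" using reals_Archimedean2 by blast
    have "dist (s i) (s j) < e" if "i \<ge> N" "j \<ge> N" for i j
    proof -
      have b: "J (s k) - m < e\<^sup>2 / 4" if "k \<ge> N" for k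
      proof -
        have "4 / e\<^sup>2 < real (Suc k)" using N that by simp
        then have "1 / real (Suc k) < e\<^sup>2 / 4"
          using \<open>e > 0\<close> by (simp add: field_simps)
        with s[of k] show ?thesis by simp
      qed
      have "(norm (s i - s j))\<^sup>2 < e\<^sup>2"
        using parallelogram[of "s i" "s j"] b[OF that(1)] b[OF that(2)] by simp
      then show ?thesis
        using \<open>e > 0\<close> by (simp add: dist_norm power_less_imp_less_base)
    qed
    then show "\<exists>M. \<forall>i\<ge>M. \<forall>j\<ge>M. dist (s i) (s j) < e" by blast
  qed
  then obtain z where z: "s \<longlonglongrightarrow> z"
    using Cauchy_convergent convergent_def by blast
  have "(\<lambda>n. J (s n)) \<longlonglongrightarrow> J z"
    unfolding J_def by (intro tendsto_intros z tendsto)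
  moreover have "(\<lambda>n. m + 1 / real (Suc n)) \<longlonglongrightarrow> m + 0"
    by (intro tendsto_intros LIMSEQ_Suc lim_1_over_n)
  ultimately have "J z \<le> m"
    using s by (intro LIMSEQ_le[of "\<lambda>n. J (s n)"]) (auto intro: less_imp_le)
  then have min: "J z \<le> J y" for y
    using m_le[of y] by simp
  have "\<phi> x = inner z x" for x
  proof (cases "x = 0")
    case False
    (* the value of the parabola t |-> J (z + t x) at its vertex *)
    define d where "d = \<phi> x - inner z x"
    define t where "t = d / (norm x)\<^sup>2"
    have "J (z + t *\<^sub>R x) = J z - 2 * t * d + t\<^sup>2 * (norm x)\<^sup>2"
      unfolding J_def d_def power2_norm_eq_inner add scaleR
      by (simp add: inner_simps inner_commute algebra_simps power2_eq_square)
    also have "\<dots> = J z - d\<^sup>2 / (norm x)\<^sup>2"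
      using False by (simp add: t_def power2_eq_square field_simps)
    finally have "d\<^sup>2 / (norm x)\<^sup>2 \<le> 0"
      using min[of "z + t *\<^sub>R x"] by simp
    with False show ?thesis
      by (simp add: d_def divide_le_0_iff)
  qed (simp add: zero)
  then show ?thesis by blast
qed

lemma real_adjoint_exists:
  fixes A :: "'a::chilbert_space \<Rightarrow>\<^sub>L 'b::complex_inner"
  shows "\<exists>B. \<forall>x y. inner (A x) y = inner x (blinfun_apply B y)"
proof -
  have "\<exists>z. \<forall>x. inner (A x) y = inner z x" for y
    by (intro riesz_representation bounded_linear_intros)
  then obtain b where b: "\<And>x y. inner (A x) y = inner (b y) x"
    by metis
  have "bounded_linear b"
  proof (rule bounded_linear_intro)
    fix s y1 y2
    have "inner (b (y1 + y2) - (b y1 + b y2)) x = 0" for x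
      by (simp add: inner_simps b[symmetric])
    from this[of "b (y1 + y2) - (b y1 + b y2)"] show "b (y1 + y2) = b y1 + b y2"
      by simp
    have "inner (b (s *\<^sub>R y1) - s *\<^sub>R b y1) x = 0" for x
      by (simp add: inner_simps b[symmetric])
    from this[of "b (s *\<^sub>R y1) - s *\<^sub>R b y1"] show "b (s *\<^sub>R y1) = s *\<^sub>R b y1"
      by simp
    have "norm (b y1) * norm (b y1) = inner (A (b y1)) y1"
      by (simp add: b power2_norm_eq_inner[symmetric] power2_eq_square)
    also have "\<dots> \<le> norm A * norm (b y1) * norm y1"
      by (intro order_trans[OF norm_cauchy_schwarz] mult_right_mono norm_blinfun norm_ge_zero)
    finally show "norm (b y1) \<le> norm y1 * norm A"
      by (cases "b y1 = 0") (auto simp: mult_ac)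
  qed
  then show ?thesis
    by (intro exI[of _ "Blinfun b"]) (simp add: bounded_linear_Blinfun_apply b, simp add: inner_commute)
qed

lemma cinner_right_cancel:
  fixes u v :: "'a::complex_inner"
  assumes "\<And>x. cinner x u = cinner x v"
  shows "u = v"
proof -
  have "inner (u - v) (u - v) = 0"
    using assms[of "u - v"] by (simp add: inner_diff_right) (simp add: inner_Re_cinner)
  then show ?thesis by simp
qed

lemma cadjointI:
  fixes A :: "'a::complex_inner \<Rightarrow>\<^sub>L 'b::complex_inner"
  assumes "\<And>x y. cinner (A x) y = cinner x (blinfun_apply B y)"
  shows "cadjoint A = B"
  unfolding cadjoint_def
proof (rule the_equality)
  fix B' assume "\<forall>x y. cinner (A x) y = cinner x (blinfun_apply B' y)"
  then show "B' = B"
    using assms by - (rule blinfun_eqI, rule cinner_right_cancel, metis)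
qed (use assms in auto)

lemma clinear_opD: "clinear_op A \<Longrightarrow> blinfun_apply A (c *\<^sub>C x) = c *\<^sub>C blinfun_apply A x"
  by (simp add: clinear_op_def)

text \<open>The real adjoint of a complex-linear operator is already its complex adjoint, because the
  imaginary part of \<open>\<langle>x, y\<rangle>\<close> is the real inner product of \<open>x\<close> with \<open>\<i> y\<close>.\<close>

lemma cinner_cadjoint:
  fixes A :: "'a::chilbert_space \<Rightarrow>\<^sub>L 'b::complex_inner"
  assumes "clinear_op A"
  shows "cinner (A x) y = cinner x (cadjoint A y)"
proof -
  obtain B where B: "\<And>x y. inner (A x) y = inner x (blinfun_apply B y)"
    using real_adjoint_exists[of A] by blast
  have "cinner (A x) y = cinner x (B y)" for x y
  proof (rule cinner_eqI[OF B])
    have "inner (A x) (\<i> *\<^sub>C y) = inner (A (\<i> *\<^sub>C x)) (- y)"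
      by (metis assms clinear_opD inner_scaleC_ii scaleC_ii_ii)
    also have "\<dots> = inner x (\<i> *\<^sub>C B y)"
      by (metis B blinfun.minus_right inner_scaleC_ii scaleC_ii_ii)
    finally show "inner (A x) (\<i> *\<^sub>C y) = inner x (\<i> *\<^sub>C B y)" .
  qed
  then show ?thesis
    using cadjointI[of A B] by simp
qed

lemma
  fixes A :: "'a::chilbert_space \<Rightarrow>\<^sub>L 'b::complex_inner"
  assumes "clinear_op A"
  shows inner_cadjoint: "inner (A x) y = inner x (cadjoint A y)"
    and clinear_op_cadjoint: "clinear_op (cadjoint A)"
    and cadjoint_cadjoint: "cadjoint (cadjoint A) = A"
proof -
  note * = cinner_cadjoint[OF assms]
  show "inner (A x) y = inner x (cadjoint A y)"
    by (simp add: inner_Re_cinner *)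
  show "clinear_op (cadjoint A)"
    unfolding clinear_op_def
    by (intro allI, rule cinner_right_cancel) (simp add: *[symmetric] cinner_scaleC_right)
  show "cadjoint (cadjoint A) = A"
    by (rule cadjointI) (metis * cinner_commute)
qed

section \<open>Symmetric and positive operators\<close>

text \<open>Symmetry is stated for the real inner product: this is self-adjointness for complex-linear
  operators, and the real form suffices for all spectral estimates below.\<close>

definition symmetric_op :: "('a::real_inner \<Rightarrow>\<^sub>L 'a) \<Rightarrow> bool" where
  "symmetric_op A \<longleftrightarrow> (\<forall>x y. inner (blinfun_apply A x) y = inner x (blinfun_apply A y))"

lemma symmetric_opD: "symmetric_op A \<Longrightarrow> inner (blinfun_apply A x) y = inner x (blinfun_apply A y)"
  by (simp add: symmetric_op_def)

lemma cinner_symmetric_op: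
  fixes A :: "'a::complex_inner \<Rightarrow>\<^sub>L 'a"
  assumes "symmetric_op A" and "clinear_op A"
  shows "cinner (A x) y = cinner x (A y)"
  using assms by (intro cinner_eqI) (simp_all add: symmetric_opD flip: clinear_opD)

lemma positive_opI:
  fixes A :: "'a::complex_inner \<Rightarrow>\<^sub>L 'a"
  assumes "clinear_op A" and "symmetric_op A" and "\<And>x. 0 \<le> inner (A x) x"
  shows "positive_op A"
  unfolding positive_op_def complex_nonneg_Reals_iff
proof (intro conjI allI)
  fix x
  have "cinner (A x) x = cnj (cinner (A x) x)"
    using cinner_symmetric_op[OF assms(2,1)] cinner_commute[of x "A x"] by metis
  then show "Im (cinner (A x) x) = 0"
    by (metis cnj.simps(2) neg_equal_zero)
qed (use assms in \<open>simp_all add: inner_Re_cinner\<close>)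

text \<open>That the quadratic form is real means that the real form \<open>inner (A x) (\<i> y)\<close> is
  alternating, hence skew; replacing \<open>y\<close> by \<open>\<i> y\<close> turns skewness into symmetry of \<open>A\<close>.\<close>

lemma
  fixes A :: "'a::complex_inner \<Rightarrow>\<^sub>L 'a"
  assumes "positive_op A"
  shows positive_op_clinear: "clinear_op A"
    and positive_op_nonneg: "0 \<le> inner (A x) x"
    and positive_op_symmetric: "symmetric_op A"
proof -
  show cl: "clinear_op A"
    using assms by (simp add: positive_op_def)
  show "0 \<le> inner (A x) x"
    using assms by (simp add: positive_op_def inner_Re_cinner complex_nonneg_Reals_iff)
  have alternating: "inner (A x) (\<i> *\<^sub>C x) = 0" for x
    using assms by (simp add: positive_op_def Im_cinner[symmetric] complex_nonneg_Reals_iff)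
  have skew: "inner (A x) (\<i> *\<^sub>C y) = - inner (A y) (\<i> *\<^sub>C x)" for x y
    using alternating[of "x + y"]
    by (simp add: blinfun.add_right scaleC_add_right inner_simps alternating)
  have "inner (A x) y = inner x (A y)" for x y
    using skew[of x "\<i> *\<^sub>C y"]
    by (simp add: clinear_opD[OF cl] scaleC_ii_ii inner_scaleC_ii inner_commute)
  then show "symmetric_op A"
    by (simp add: symmetric_op_def)
qed

lemma positive_op_cadjoint_compose:
  fixes T :: "'a::chilbert_space \<Rightarrow>\<^sub>L 'b::complex_inner"
  assumes "clinear_op T"
  shows "positive_op (cadjoint T o\<^sub>L T)"
proof (rule positive_opI)
  have s: "inner (cadjoint T u) v = inner u (T v)" for u v
    using inner_cadjoint[OF assms, of v u] by (simp add: inner_commute)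
  show "clinear_op (cadjoint T o\<^sub>L T)"
    using assms clinear_op_cadjoint[OF assms] by (simp add: clinear_op_def)
  show "symmetric_op (cadjoint T o\<^sub>L T)"
    by (simp add: symmetric_op_def s inner_cadjoint[OF assms])
  show "0 \<le> inner ((cadjoint T o\<^sub>L T) x) x" for x
    by (simp add: s)
qed

section \<open>Polynomials of an operator\<close>

lemma poly_op_altdef:
  assumes "degree p \<le> n"
  shows "poly_op p A = (\<Sum>i\<le>n. coeff p i *\<^sub>R (((o\<^sub>L) A) ^^ i) id_blinfun)"
  unfolding poly_op_def
  by (rule sum.mono_neutral_left) (use assms in \<open>auto intro: coeff_eq_0\<close>)

lemma poly_op_0 [simp]: "poly_op 0 A = 0"
  by (simp add: poly_op_def)

lemma poly_op_pCons [simp]: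
  "poly_op (pCons a p) A = a *\<^sub>R id_blinfun + (A o\<^sub>L poly_op p A)"
proof -
  have "degree (pCons a p) \<le> Suc (degree p)"
    by (simp add: degree_pCons_le)
  then have "poly_op (pCons a p) A = a *\<^sub>R id_blinfun +
      (\<Sum>i\<le>degree p. coeff p i *\<^sub>R (A o\<^sub>L (((o\<^sub>L) A) ^^ i) id_blinfun))"
    by (simp only: poly_op_altdef sum.atMost_Suc_shift) simp
  also have "(\<Sum>i\<le>degree p. coeff p i *\<^sub>R (A o\<^sub>L (((o\<^sub>L) A) ^^ i) id_blinfun)) = A o\<^sub>L poly_op p A"
    by (simp add: poly_op_def bounded_bilinear.sum_right[OF bounded_bilinear_blinfun_compose]
        bounded_bilinear.scaleR_right[OF bounded_bilinear_blinfun_compose])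
  finally show ?thesis .
qed

lemma poly_op_add: "poly_op (p + q) A = poly_op p A + poly_op q A"
  by (induction p q rule: poly_induct2)
    (auto intro!: blinfun_eqI simp: blinfun.bilinear_simps algebra_simps)

lemma poly_op_smult: "poly_op (smult c p) A = c *\<^sub>R poly_op p A"
  by (induction p) (auto intro!: blinfun_eqI simp: blinfun.bilinear_simps algebra_simps)

lemma poly_op_diff: "poly_op (p - q) A = poly_op p A - poly_op q A"
  using poly_op_add[of p "- q" A] poly_op_smult[of "-1" q A] by simp

lemma poly_op_mult: "poly_op (p * q) A = poly_op p A o\<^sub>L poly_op q A"
  by (induction p)
    (auto intro!: blinfun_eqI simp: blinfun.bilinear_simps poly_op_add poly_op_smult mult_pCons_left)

text \<open>The polynomials \<open>p(x\<^sup>2)\<close> relate the calculus of an operator to that of its square; this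
  gives the uniqueness of positive square roots.\<close>

lemma poly_op_pcompose_square: "poly_op (p \<circ>\<^sub>p [:0, 0, 1:]) A = poly_op p (A o\<^sub>L A)"
  by (induction p)
    (auto intro!: blinfun_eqI
      simp: blinfun.bilinear_simps poly_op_add poly_op_smult poly_op_mult pcompose_pCons)

lemma poly_op_intertwine:
  assumes "T o\<^sub>L A = B o\<^sub>L T"
  shows "T o\<^sub>L poly_op p A = poly_op p B o\<^sub>L T"
proof (induction p)
  case (pCons a p)
  have *: "blinfun_apply T (blinfun_apply A x) = blinfun_apply B (blinfun_apply T x)" for x
    using assms by (metis blinfun_apply_blinfun_compose)
  have "blinfun_apply T (blinfun_apply (poly_op p A) x) = blinfun_apply (poly_op p B) (blinfun_apply T x)" for x
    using pCons.IH by (metis blinfun_apply_blinfun_compose)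
  then show ?case
    by (intro blinfun_eqI) (simp add: blinfun.bilinear_simps *)
qed simp

lemma poly_op_commute: "A o\<^sub>L poly_op p A = poly_op p A o\<^sub>L A"
  by (rule poly_op_intertwine) simp

lemma symmetric_op_poly_op:
  assumes "symmetric_op A"
  shows "symmetric_op (poly_op p A)"
proof (induction p)
  case (pCons a p)
  have "blinfun_apply A (blinfun_apply (poly_op p A) x) = blinfun_apply (poly_op p A) (blinfun_apply A x)" for x
    using poly_op_commute[of A p] by (metis blinfun_apply_blinfun_compose)
  with pCons.IH assms show ?case
    by (simp add: symmetric_op_def blinfun.bilinear_simps inner_simps)
qed (simp add: symmetric_op_def)

lemma clinear_op_poly_op:
  fixes A :: "'a::complex_inner \<Rightarrow>\<^sub>L 'a"
  assumes "clinear_op A"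
  shows "clinear_op (poly_op p A)"
proof (induction p)
  case 0
  have "c *\<^sub>C (0 :: 'a) = 0" for c
    using norm_scaleC[of c "0 :: 'a"] by simp
  then show ?case
    by (simp add: clinear_op_def)
next
  case (pCons a p)
  have "a *\<^sub>R c *\<^sub>C x = c *\<^sub>C a *\<^sub>R x" for c and x :: 'a
    by (simp add: scaleR_scaleC scaleC_scaleC mult.commute)
  with pCons.IH assms show ?case
    by (simp add: clinear_op_def blinfun.bilinear_simps scaleC_add_right)
qed

section \<open>The spectrum of a positive operator\<close>

text \<open>For a symmetric operator on a Hilbert space this is equivalent to invertibility, but products
  are handled by a bare norm estimate, without constructing inverses.\<close>

definition bounded_below_op :: "('a::real_normed_vector \<Rightarrow>\<^sub>L 'b::real_normed_vector) \<Rightarrow> bool" where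
  "bounded_below_op A \<longleftrightarrow> (\<exists>c>0. \<forall>x. c * norm x \<le> norm (blinfun_apply A x))"

lemma bounded_below_op_compose:
  assumes "bounded_below_op A" and "bounded_below_op B"
  shows "bounded_below_op (A o\<^sub>L B)"
proof -
  obtain a b where ab: "a > 0" "b > 0"
    and A: "\<And>x. a * norm x \<le> norm (blinfun_apply A x)"
    and B: "\<And>x. b * norm x \<le> norm (blinfun_apply B x)"
    using assms by (auto simp: bounded_below_op_def)
  have "a * b * norm x \<le> norm (blinfun_apply A (blinfun_apply B x))" for x
  proof -
    have "a * (b * norm x) \<le> a * norm (blinfun_apply B x)"
      using ab B by (intro mult_left_mono) auto
    also have "\<dots> \<le> norm (blinfun_apply A (blinfun_apply B x))" by (rule A)
    finally show ?thesis by (simp add: mult.assoc)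
  qed
  with ab show ?thesis
    by (auto simp: bounded_below_op_def intro!: exI[of _ "a * b"])
qed

lemma coercive_imp_bounded_below_op:
  fixes B :: "'a::real_inner \<Rightarrow>\<^sub>L 'a"
  assumes "c > 0" and "\<And>x. c * (norm x)\<^sup>2 \<le> inner (B x) x"
  shows "c * norm x \<le> norm (B x)" and "bounded_below_op B"
proof -
  show *: "c * norm x \<le> norm (B x)" for x
  proof (cases "x = 0")
    case False
    have "c * norm x * norm x \<le> norm (B x) * norm x"
      using order_trans[OF assms(2) norm_cauchy_schwarz] by (simp add: power2_eq_square mult.assoc)
    with False show ?thesis by simp
  qed simp
  with assms(1) show "bounded_below_op B"
    by (auto simp: bounded_below_op_def)
qed

text \<open>The Lax--Milgram argument: for small \<open>s > 0\<close> the map \<open>x \<mapsto> x - s (B x - y)\<close> is a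
  contraction, and its unique fixed point is the unique solution of \<open>B x = y\<close>.\<close>

lemma coercive_invertible:
  fixes B :: "'a::chilbert_space \<Rightarrow>\<^sub>L 'a"
  assumes c: "c > 0" and coercive: "\<And>x. c * (norm x)\<^sup>2 \<le> inner (B x) x"
  shows "\<exists>C. C o\<^sub>L B = id_blinfun \<and> B o\<^sub>L C = id_blinfun"
proof -
  define K where "K = norm B + c"
  have K: "K > 0" "c \<le> K" "norm B \<le> K"
    using c by (auto simp: K_def add_nonneg_pos)
  (* the minimizer of 1 - 2 s c + s^2 K^2, which bounds the squared Lipschitz constant *)
  define s where "s = c / K\<^sup>2"
  have s: "s > 0" using c K by (simp add: s_def)
  define q where "q = sqrt (1 - c\<^sup>2 / K\<^sup>2)"
  have "c\<^sup>2 / K\<^sup>2 \<le> 1"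
    using c K by (simp add: power_mono)
  then have q: "0 \<le> q" "q < 1"
    using c K by (auto simp: q_def)
  have contract: "norm (x - s *\<^sub>R B x) \<le> q * norm x" for x
  proof -
    have "norm (B x) \<le> K * norm x"
      using norm_blinfun[of B x] mult_right_mono[OF K(3) norm_ge_zero[of x]] by linarith
    then have Bx: "(norm (B x))\<^sup>2 \<le> K\<^sup>2 * (norm x)\<^sup>2"
      by (metis norm_ge_zero power_mono power_mult_distrib)
    have "(norm (x - s *\<^sub>R B x))\<^sup>2 = (norm x)\<^sup>2 - 2 * s * inner (B x) x + s\<^sup>2 * (norm (B x))\<^sup>2"
      unfolding power2_norm_eq_inner
      by (simp add: inner_simps inner_commute algebra_simps power2_eq_square)
    also have "\<dots> \<le> (norm x)\<^sup>2 - 2 * s * (c * (norm x)\<^sup>2) + s\<^sup>2 * (K\<^sup>2 * (norm x)\<^sup>2)"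
      using s coercive[of x] Bx by (intro add_mono diff_mono mult_left_mono) auto
    also have "\<dots> = (1 - c\<^sup>2 / K\<^sup>2) * (norm x)\<^sup>2"
      using K by (simp add: s_def field_simps power2_eq_square)
    also have "\<dots> = (q * norm x)\<^sup>2"
      using \<open>c\<^sup>2 / K\<^sup>2 \<le> 1\<close> by (simp add: q_def power_mult_distrib)
    finally show ?thesis
      by (rule power2_le_imp_le) (use q in simp)
  qed
  have "\<exists>!x. B x = y" for y
  proof -
    have "\<exists>!x. x - s *\<^sub>R (B x - y) = x"
    proof (rule banach_fix_type[OF q], intro allI)
      fix u v
      have "u - s *\<^sub>R (B u - y) - (v - s *\<^sub>R (B v - y)) = (u - v) - s *\<^sub>R B (u - v)"
        by (simp add: blinfun.bilinear_simps algebra_simps)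
      then show "dist (u - s *\<^sub>R (B u - y)) (v - s *\<^sub>R (B v - y)) \<le> q * dist u v"
        unfolding dist_norm by (simp only: contract)
    qed
    with s show ?thesis by simp
  qed
  then obtain C where C: "\<And>y. B (C y) = y" and C': "\<And>x y. B x = y \<Longrightarrow> x = C y"
    by metis
  have "bounded_linear C"
  proof (rule bounded_linear_intro)
    show "C (x + y) = C x + C y" for x y
      by (rule C'[symmetric]) (simp add: blinfun.bilinear_simps C)
    show "C (t *\<^sub>R x) = t *\<^sub>R C x" for t x
      by (rule C'[symmetric]) (simp add: blinfun.bilinear_simps C)
    show "norm (C x) \<le> norm x * (1 / c)" for x
      using coercive_imp_bounded_below_op(1)[OF c coercive, of "C x"] c
      by (simp add: C field_simps)
  qed
  moreover have "C (B x) = x" for x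
    using C'[of x "B x"] by simp
  ultimately show ?thesis
    by (intro exI[of _ "Blinfun C"] conjI blinfun_eqI)
      (simp_all add: bounded_linear_Blinfun_apply C)
qed

abbreviation real_spectrum :: "('a::complex_inner \<Rightarrow>\<^sub>L 'a) \<Rightarrow> real set" where
  "real_spectrum A \<equiv> {t. complex_of_real t \<in> op_spectrum A}"

lemma scalar_op_of_real: "scalar_op (complex_of_real t) = t *\<^sub>R id_blinfun"
  by (rule blinfun_eqI) (simp add: scalar_op.rep_eq blinfun.bilinear_simps scaleR_scaleC)

text \<open>Outside \<open>[0, \<parallel>A\<parallel>]\<close> either \<open>A - t\<close> or \<open>t - A\<close> is coercive, hence invertible.\<close>

lemma real_spectrum_subset:
  fixes A :: "'a::chilbert_space \<Rightarrow>\<^sub>L 'a"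
  assumes pos: "\<And>x. 0 \<le> inner (A x) x"
  shows "real_spectrum A \<subseteq> {0..norm A}"
proof (rule subsetI, rule ccontr)
  fix t assume t: "t \<in> real_spectrum A" "t \<notin> {0..norm A}"
  let ?D = "A - t *\<^sub>R id_blinfun"
  have "\<exists>C. C o\<^sub>L ?D = id_blinfun \<and> ?D o\<^sub>L C = id_blinfun"
  proof (cases "t < 0")
    case True
    show ?thesis
    proof (rule coercive_invertible)
      show "- t * (norm x)\<^sup>2 \<le> inner (?D x) x" for x
        using pos[of x] by (simp add: blinfun.bilinear_simps inner_simps power2_norm_eq_inner)
    qed (use True in simp)
  next
    case False
    then have "norm A < t" using t by auto
    have "\<exists>C. C o\<^sub>L (- ?D) = id_blinfun \<and> (- ?D) o\<^sub>L C = id_blinfun"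
    proof (rule coercive_invertible)
      fix x
      have "inner (A x) x \<le> norm A * norm x * norm x"
        by (intro order_trans[OF norm_cauchy_schwarz] mult_right_mono norm_blinfun norm_ge_zero)
      moreover have "inner ((- ?D) x) x = t * (norm x)\<^sup>2 - inner (A x) x"
        by (simp add: blinfun.bilinear_simps inner_simps power2_norm_eq_inner)
      ultimately show "(t - norm A) * (norm x)\<^sup>2 \<le> inner ((- ?D) x) x"
        by (simp add: algebra_simps power2_eq_square)
    qed (use \<open>norm A < t\<close> in simp)
    then obtain C where "C o\<^sub>L (- ?D) = id_blinfun" "(- ?D) o\<^sub>L C = id_blinfun" by blast
    then have "C ((- ?D) x) = x" "(- ?D) (C x) = x" for x
      by (metis blinfun_apply_blinfun_compose blinfun_apply_id_blinfun id_apply)+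
    then show ?thesis
      by (intro exI[of _ "- C"] conjI blinfun_eqI) (simp_all add: blinfun.bilinear_simps)
  qed
  with t(1) show False
    unfolding op_spectrum_def mem_Collect_eq scalar_op_of_real by blast
qed

lemma not_in_real_spectrum_imp_bounded_below:
  assumes "t \<notin> real_spectrum A"
  shows "bounded_below_op (A - t *\<^sub>R id_blinfun)"
proof -
  let ?D = "A - t *\<^sub>R id_blinfun"
  obtain C where C: "C o\<^sub>L ?D = id_blinfun"
    using assms by (auto simp: op_spectrum_def scalar_op_of_real)
  have "inverse (norm C + 1) * norm x \<le> norm (?D x)" for x
  proof -
    have "norm x = norm (C (?D x))"
      using C by (metis blinfun_apply_blinfun_compose blinfun_apply_id_blinfun id_apply)
    also have "\<dots> \<le> norm C * norm (?D x)" by (rule norm_blinfun)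
    also have "\<dots> \<le> (norm C + 1) * norm (?D x)" by (intro mult_right_mono) auto
    finally show ?thesis
      by (simp add: divide_simps mult.commute add_nonneg_pos)
  qed
  then show ?thesis
    unfolding bounded_below_op_def by (intro exI[of _ "inverse (norm C + 1)"]) (simp add: add_nonneg_pos)
qed

text \<open>Over the reals a polynomial splits into linear factors and factors
  \<open>(x - a)\<^sup>2 + b\<^sup>2\<close> with \<open>b \<noteq> 0\<close>.\<close>

lemma real_poly_factor:
  fixes p :: "real poly"
  assumes "degree p > 0"
  obtains t s where "p = [:- t, 1:] * s"
  | a b s where "b \<noteq> 0" "p = [:a\<^sup>2 + b\<^sup>2, - 2 * a, 1:] * s"
proof -
  define ev where "ev q z = poly (map_poly complex_of_real q) z" for q z
  have ev_simps [simp]: "ev 0 z = 0" "ev (pCons c q) z = of_real c + z * ev q z" for c q z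
    by (simp_all add: ev_def map_poly_pCons)
  have ev_add: "ev (u + v) z = ev u z + ev v z" for u v z
    by (induction u v rule: poly_induct2) (simp_all add: algebra_simps)
  have ev_smult: "ev (smult c u) z = of_real c * ev u z" for c u z
    by (induction u) (simp_all add: algebra_simps)
  have ev_mult: "ev (u * v) z = ev u z * ev v z" for u v z
    by (induction u) (simp_all add: mult_pCons_left ev_add ev_smult algebra_simps)
  have ev_real: "ev u (of_real t) = of_real (poly u t)" for u t
    by (induction u) simp_all
  have "degree (map_poly complex_of_real p) > 0"
    using assms by (simp add: degree_map_poly)
  then have "\<not> constant (poly (map_poly complex_of_real p))"
    by (simp add: constant_degree)
  then obtain z where z: "ev p z = 0"
    using fundamental_theorem_of_algebra unfolding ev_def by blast
  show ?thesis
  proof (cases "Im z = 0")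
    case True
    then have "z = of_real (Re z)" by (simp add: complex_eq_iff)
    with z have "poly p (Re z) = 0"
      by (metis ev_real of_real_eq_0_iff)
    then show ?thesis
      by (auto simp: poly_eq_0_iff_dvd dvd_def intro: that(1))
  next
    case False
    (* the minimal polynomial of z over the reals; the remainder modulo it is linear and
       vanishes at the nonreal number z *)
    define q where "q = [:(Re z)\<^sup>2 + (Im z)\<^sup>2, - 2 * Re z, 1:]"
    have "ev q z = 0"
      by (simp add: q_def complex_eq_iff power2_eq_square algebra_simps)
    define m where "m = p mod q"
    have pq: "p = q * (p div q) + m"
      by (simp add: m_def)
    have "degree q = 2" by (simp add: q_def)
    then have "m = 0 \<or> degree m < 2"
      using degree_mod_less[of q p] by (auto simp: m_def q_def)
    then have "degree m \<le> 1" by auto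
    then have "m = [:coeff m 0, coeff m 1:]"
      by (intro poly_eqI) (auto simp: coeff_pCons coeff_eq_0 split: nat.split)
    then obtain u v where m: "m = [:u, v:]" by blast
    have "ev m z = 0"
      using z \<open>ev q z = 0\<close> by (subst (asm) pq) (simp add: ev_add ev_mult)
    then have "u = 0 \<and> v = 0"
      using False by (auto simp: m complex_eq_iff)
    then have "p = q * (p div q)" using pq m by simp
    then show ?thesis
      using that(2)[OF False] unfolding q_def by blast
  qed
qed

text \<open>By the factorization: a linear factor is bounded below off the spectrum, and
  \<open>(A - a)\<^sup>2 + b\<^sup>2\<close> is coercive because \<open>A\<close> is symmetric.\<close>

lemma bounded_below_poly_op:
  fixes A :: "'a::complex_inner \<Rightarrow>\<^sub>L 'a"
  assumes sym: "symmetric_op A" and "p \<noteq> 0"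
    and "\<And>t. t \<in> real_spectrum A \<Longrightarrow> poly p t \<noteq> 0"
  shows "bounded_below_op (poly_op p A)"
  using assms(2,3)
proof (induction "degree p" arbitrary: p rule: less_induct)
  case less
  show ?case
  proof (cases "degree p = 0")
    case True
    then obtain c where c: "p = [:c:]" by (rule degree_eq_zeroE)
    with less.prems show ?thesis
      by (auto simp: bounded_below_op_def blinfun.bilinear_simps intro!: exI[of _ "\<bar>c\<bar>"])
  next
    case False
    have step: "bounded_below_op (poly_op p A)"
      if p: "p = q * s" and q: "bounded_below_op (poly_op q A)" and "degree q > 0" for q s
    proof -
      have ne: "q \<noteq> 0" "s \<noteq> 0" using less.prems p by auto
      then have "degree s < degree p"
        using p that(3) by (simp add: degree_mult_eq)
      then have "bounded_below_op (poly_op s A)"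
        using less.hyps less.prems ne p by simp
      with q show ?thesis
        by (simp add: p poly_op_mult bounded_below_op_compose)
    qed
    from False have "degree p > 0" by simp
    then show ?thesis
    proof (cases rule: real_poly_factor)
      case (1 t s)
      then have "poly p t = 0" by simp
      then have "bounded_below_op (A - t *\<^sub>R id_blinfun)"
        using less.prems(2) by (intro not_in_real_spectrum_imp_bounded_below) blast
      moreover have "A - t *\<^sub>R id_blinfun = poly_op [:- t, 1:] A"
        by (rule blinfun_eqI) (simp add: blinfun.bilinear_simps)
      ultimately show ?thesis
        using step[OF 1] by simp
    next
      case (2 a b s)
      let ?q = "[:a\<^sup>2 + b\<^sup>2, - 2 * a, 1:]"
      have "bounded_below_op (poly_op ?q A)"
      proof (rule coercive_imp_bounded_below_op(2))
        fix x
        have "inner (poly_op ?q A x) x = (norm (A x - a *\<^sub>R x))\<^sup>2 + b\<^sup>2 * (norm x)\<^sup>2"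
          unfolding power2_norm_eq_inner
          using symmetric_opD[OF sym, of "A x" x]
          by (simp add: blinfun.bilinear_simps inner_simps inner_commute algebra_simps power2_eq_square)
        then show "b\<^sup>2 * (norm x)\<^sup>2 \<le> inner (poly_op ?q A x) x" by simp
      qed (use 2 in simp)
      then show ?thesis
        using step[OF 2(2)] by simp
    qed
  qed
qed

text \<open>On almost norm-attaining vectors \<open>x\<close> the vector \<open>(\<parallel>B\<parallel>\<^sup>2 - B\<^sup>2) x\<close> is small:
  \<open>\<parallel>(\<parallel>B\<parallel>\<^sup>2 - B\<^sup>2) x\<parallel>\<^sup>2 \<le> \<parallel>B\<parallel>\<^sup>4 \<parallel>x\<parallel>\<^sup>2 - \<parallel>B\<parallel>\<^sup>2 \<parallel>B x\<parallel>\<^sup>2\<close>. A lower bound for the left-hand side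
  would therefore bound \<open>B\<close> by less than its norm.\<close>

lemma not_bounded_below_norm_square:
  fixes B :: "'a::real_inner \<Rightarrow>\<^sub>L 'a"
  assumes sym: "symmetric_op B" and "B \<noteq> 0"
  shows "\<not> bounded_below_op ((norm B)\<^sup>2 *\<^sub>R id_blinfun - (B o\<^sub>L B))"
proof
  let ?M = "norm B"
  let ?D = "?M\<^sup>2 *\<^sub>R id_blinfun - (B o\<^sub>L B)"
  have M: "?M > 0" using assms by simp
  assume "bounded_below_op ?D"
  then obtain c where c: "c > 0" and bb: "\<And>x. c * norm x \<le> norm (?D x)"
    by (auto simp: bounded_below_op_def)
  (* half of the gap that the lower bound c leaves below norm B squared *)
  define \<delta> where "\<delta> = c\<^sup>2 / (2 * ?M\<^sup>2)"
  have \<delta>: "\<delta> > 0" using c M by (simp add: \<delta>_def)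
  have key: "(norm (B x))\<^sup>2 \<le> (?M\<^sup>2 - \<delta>) * (norm x)\<^sup>2" for x
  proof -
    have "(norm (B (B x)))\<^sup>2 \<le> (?M * norm (B x))\<^sup>2"
      by (intro power_mono norm_blinfun norm_ge_zero)
    moreover have "(norm (B x))\<^sup>2 \<le> (?M * norm x)\<^sup>2"
      by (intro power_mono norm_blinfun norm_ge_zero)
    moreover have "(norm (?D x))\<^sup>2 = ?M ^ 4 * (norm x)\<^sup>2 - 2 * ?M\<^sup>2 * (norm (B x))\<^sup>2 + (norm (B (B x)))\<^sup>2"
    proof -
      have "inner (B (B x)) x = (norm (B x))\<^sup>2"
        by (simp add: symmetric_opD[OF sym] power2_norm_eq_inner)
      moreover have "(norm (?D x))\<^sup>2 = (?M\<^sup>2)\<^sup>2 * (norm x)\<^sup>2 - 2 * ?M\<^sup>2 * inner (B (B x)) x + (norm (B (B x)))\<^sup>2"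
        unfolding power2_norm_eq_inner[where 'a='a]
        by (simp add: blinfun.bilinear_simps inner_simps inner_commute algebra_simps power2_eq_square)
      ultimately show ?thesis by simp
    qed
    moreover have "(c * norm x)\<^sup>2 \<le> (norm (?D x))\<^sup>2"
      using c by (intro power_mono bb) auto
    ultimately have "c\<^sup>2 * (norm x)\<^sup>2 \<le> ?M ^ 4 * (norm x)\<^sup>2 - ?M\<^sup>2 * (norm (B x))\<^sup>2"
      by (simp add: power_mult_distrib)
    also have "\<dots> = ?M\<^sup>2 * (?M\<^sup>2 * (norm x)\<^sup>2 - (norm (B x))\<^sup>2)"
      by (simp add: algebra_simps power2_eq_square power4_eq_xxxx)
    finally have "c\<^sup>2 * (norm x)\<^sup>2 / ?M\<^sup>2 \<le> ?M\<^sup>2 * (norm x)\<^sup>2 - (norm (B x))\<^sup>2"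
      using M by (simp add: pos_divide_le_eq mult.commute)
    moreover have "\<delta> * (norm x)\<^sup>2 \<le> c\<^sup>2 * (norm x)\<^sup>2 / ?M\<^sup>2"
      using M by (simp add: \<delta>_def field_simps)
    ultimately show ?thesis by (simp add: algebra_simps)
  qed
  obtain x0 where "B x0 \<noteq> 0"
    using assms(2) by (metis blinfun_eqI blinfun.zero_left)
  then have "0 < (norm (B x0))\<^sup>2" "x0 \<noteq> 0" by (auto simp: blinfun.bilinear_simps)
  with key[of x0] have nn: "0 \<le> ?M\<^sup>2 - \<delta>"
    by (smt (verit) mult_nonneg_nonneg mult_neg_pos zero_less_power zero_less_norm_iff)
  have "norm B \<le> sqrt (?M\<^sup>2 - \<delta>)"
  proof (rule norm_blinfun_bound)
    show "norm (B x) \<le> sqrt (?M\<^sup>2 - \<delta>) * norm x" for x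
      using real_sqrt_le_mono[OF key[of x]] by (simp add: real_sqrt_mult)
  qed (use nn in simp)
  then have "?M\<^sup>2 \<le> ?M\<^sup>2 - \<delta>"
    using nn M by (metis norm_ge_zero power_mono real_sqrt_pow2)
  with \<delta> show False by simp
qed

text \<open>The spectral radius formula for \<open>B = p(A)\<close>, in the form that is used: \<open>\<parallel>B\<parallel>\<^sup>2 - B\<^sup>2\<close> is a
  polynomial of \<open>A\<close> that is not bounded below, so \<open>\<parallel>B\<parallel>\<^sup>2 - p\<^sup>2\<close> vanishes somewhere on the
  spectrum of \<open>A\<close>. If this polynomial is zero, any spectral point will do, and the same argument
  with \<open>p = x\<close> shows that there is one if \<open>A \<noteq> 0\<close>; for \<open>A = 0\<close> the point \<open>0\<close> is in the spectrum.\<close>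

lemma norm_poly_op_attained:
  fixes A :: "'a::complex_inner \<Rightarrow>\<^sub>L 'a"
  assumes sym: "symmetric_op A" and ne: "poly_op p A \<noteq> 0"
  shows "\<exists>t\<in>real_spectrum A. \<bar>poly p t\<bar> = norm (poly_op p A)"
proof -
  have attained: "\<exists>t\<in>real_spectrum A. \<bar>poly p t\<bar> = norm (poly_op p A)"
    if ne: "poly_op p A \<noteq> 0" and q0: "[:(norm (poly_op p A))\<^sup>2:] - p * p \<noteq> 0" for p
  proof -
    let ?M = "norm (poly_op p A)"
    let ?q = "[:?M\<^sup>2:] - p * p"
    have "poly_op ?q A = ?M\<^sup>2 *\<^sub>R id_blinfun - (poly_op p A o\<^sub>L poly_op p A)"
      by (rule blinfun_eqI) (simp add: poly_op_diff poly_op_mult blinfun.bilinear_simps)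
    then have "\<not> bounded_below_op (poly_op ?q A)"
      using not_bounded_below_norm_square[OF symmetric_op_poly_op[OF sym] ne] by simp
    then obtain t where t: "t \<in> real_spectrum A" "poly ?q t = 0"
      using bounded_below_poly_op[OF sym q0] by blast
    then have "(poly p t)\<^sup>2 = ?M\<^sup>2" by (simp add: power2_eq_square)
    then have "\<bar>poly p t\<bar> = ?M" by (metis abs_norm_cancel power2_eq_iff abs_minus_cancel)
    with t show ?thesis by blast
  qed
  have nonempty: "real_spectrum A \<noteq> {}"
  proof (cases "A = 0")
    case True
    show ?thesis
    proof
      assume "real_spectrum A = {}"
      then have "bounded_below_op (A - 0 *\<^sub>R id_blinfun)"
        by (intro not_in_real_spectrum_imp_bounded_below) blast
      then obtain c where "c > 0" "\<And>x::'a. c * norm x \<le> 0"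
        by (auto simp: True bounded_below_op_def)
      then have "x = 0" for x :: 'a
        by (metis mult_le_0_iff norm_le_zero_iff not_less)
      with ne show False by (metis blinfun_eqI)
    qed
  next
    case False
    have x: "poly_op [:0, 1:] A = A" by (rule blinfun_eqI) (simp add: blinfun.bilinear_simps)
    have "\<exists>t\<in>real_spectrum A. \<bar>poly [:0, 1:] t\<bar> = norm (poly_op [:0, 1:] A)"
      by (rule attained) (use False x in auto)
    then show ?thesis by blast
  qed
  show ?thesis
  proof (cases "[:(norm (poly_op p A))\<^sup>2:] - p * p = 0")
    case True
    obtain t where t: "t \<in> real_spectrum A" using nonempty by blast
    have "poly ([:(norm (poly_op p A))\<^sup>2:] - p * p) t = 0" by (simp only: True poly_0)
    then have "(poly p t)\<^sup>2 = (norm (poly_op p A))\<^sup>2" by (simp add: power2_eq_square)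
    then have "\<bar>poly p t\<bar> = norm (poly_op p A)" by (metis abs_norm_cancel power2_eq_iff abs_minus_cancel)
    with t show ?thesis by blast
  qed (rule attained[OF ne])
qed

lemma norm_poly_op_le:
  assumes "symmetric_op A" and "0 \<le> c" and "\<And>t. t \<in> real_spectrum A \<Longrightarrow> \<bar>poly p t\<bar> \<le> c"
  shows "norm (poly_op p A) \<le> c"
  using norm_poly_op_attained[OF assms(1), of p] assms(2,3)
  by (cases "poly_op p A = 0") fastforce+

section \<open>The continuous functional calculus of a positive operator\<close>

lemma real_poly_uniform_approximation:
  fixes h :: "real \<Rightarrow> real"
  assumes "continuous_on {a..b} h"
  obtains p where "uniform_limit {a..b} (\<lambda>n. poly (p n)) h sequentially"
proof -
  obtain G where G: "uniform_limit {a..b} G h sequentially" "\<And>n. polynomial_function (G n)"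
    using Stone_Weierstrass_uniform_limit[OF compact_Icc assms] by blast
  have "\<exists>p. G n = poly p" for n
  proof -
    obtain c N where "G n = (\<lambda>x. \<Sum>i\<le>N. c i * x ^ i)"
      using G(2)[of n] real_polynomial_function_eq real_polynomial_function_iff_sum by metis
    then have "G n = poly (\<Sum>i\<le>N. monom (c i) i)"
      by (simp add: fun_eq_iff poly_sum poly_monom)
    then show ?thesis by blast
  qed
  then obtain p where "\<And>n. G n = poly (p n)" by metis
  then have "G = (\<lambda>n. poly (p n))" by blast
  with G(1) show ?thesis using that by blast
qed

text \<open>This one estimate yields both the convergence of \<open>p\<^sub>n(A)\<close> (with \<open>q = p\<close>) and the
  independence of the limit from the approximating sequence.\<close>

lemma eventually_norm_poly_op_diff_le:
  fixes A :: "'a::complex_inner \<Rightarrow>\<^sub>L 'a"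
  assumes sym: "symmetric_op A"
    and p: "uniform_limit (real_spectrum A) (\<lambda>n. poly (p n)) h F"
    and q: "uniform_limit (real_spectrum A) (\<lambda>n. poly (q n)) h G"
    and "e > 0"
  shows "\<forall>\<^sub>F m in F. \<forall>\<^sub>F n in G. norm (poly_op (p m) A - poly_op (q n) A) < e"
proof -
  have "e / 3 > 0" using \<open>e > 0\<close> by simp
  show ?thesis
    using uniform_limitD[OF p \<open>e / 3 > 0\<close>]
  proof (rule eventually_mono)
    fix m
    assume p: "\<forall>t\<in>real_spectrum A. dist (poly (p m) t) (h t) < e / 3"
    show "\<forall>\<^sub>F n in G. norm (poly_op (p m) A - poly_op (q n) A) < e"
      using uniform_limitD[OF q \<open>e / 3 > 0\<close>]
    proof (rule eventually_mono)
      fix n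
      assume q: "\<forall>t\<in>real_spectrum A. dist (poly (q n) t) (h t) < e / 3"
      have "norm (poly_op (p m - q n) A) \<le> 2 * (e / 3)"
      proof (rule norm_poly_op_le[OF sym])
        fix t assume "t \<in> real_spectrum A"
        then have "\<bar>poly (p m) t - h t\<bar> < e / 3" "\<bar>poly (q n) t - h t\<bar> < e / 3"
          using p q by (simp_all add: dist_real_def)
        then show "\<bar>poly (p m - q n) t\<bar> \<le> 2 * (e / 3)"
          by (simp add: abs_real_def split: if_splits)
      qed (use \<open>e > 0\<close> in simp)
      then show "norm (poly_op (p m) A - poly_op (q n) A) < e"
        using \<open>e > 0\<close> by (simp add: poly_op_diff)
    qed
  qed
qed

text \<open>The defining property of the calculus, on an interval that may be larger than the spectrum:
  two operators, or an operator and its square, can then share one approximating sequence.\<close>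

lemma cfc_tendsto:
  fixes A :: "'a::chilbert_space \<Rightarrow>\<^sub>L 'a"
  assumes A: "positive_op A" and h: "continuous_on {0..} h"
    and "norm A \<le> M" and q: "uniform_limit {0..M} (\<lambda>n. poly (q n)) h sequentially"
  shows "(\<lambda>n. poly_op (q n) A) \<longlonglongrightarrow> cfc h A"
proof -
  note sym = positive_op_symmetric[OF A]
  have spec: "real_spectrum A \<subseteq> {0..norm A}"
    by (rule real_spectrum_subset) (rule positive_op_nonneg[OF A])
  have "continuous_on {0..norm A} h"
    by (rule continuous_on_subset[OF h]) auto
  then obtain p where "uniform_limit {0..norm A} (\<lambda>n. poly (p n)) h sequentially"
    by (rule real_poly_uniform_approximation)
  then have p: "uniform_limit (real_spectrum A) (\<lambda>n. poly (p n)) h sequentially"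
    using spec by (rule uniform_limit_on_subset)
  have "Cauchy (\<lambda>n. poly_op (p n) A)"
  proof (rule metric_CauchyI)
    fix e :: real assume "e > 0"
    then have "e / 2 > 0" by simp
    from eventually_norm_poly_op_diff_le[OF sym p p this]
    obtain m where "\<forall>\<^sub>F n in sequentially. norm (poly_op (p m) A - poly_op (p n) A) < e / 2"
      unfolding eventually_sequentially by blast
    then obtain N where N: "\<And>n. n \<ge> N \<Longrightarrow> dist (poly_op (p n) A) (poly_op (p m) A) < e / 2"
      unfolding eventually_sequentially dist_norm by (metis norm_minus_commute)
    then show "\<exists>N. \<forall>i\<ge>N. \<forall>j\<ge>N. dist (poly_op (p i) A) (poly_op (p j) A) < e"
      using dist_triangle_half_l by metis
  qed
  then obtain B where B: "(\<lambda>n. poly_op (p n) A) \<longlonglongrightarrow> B"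
    using Cauchy_convergent convergent_def by blast
  have lim: "(\<lambda>n. poly_op (q n) A) \<longlonglongrightarrow> B"
    if q: "uniform_limit (real_spectrum A) (\<lambda>n. poly (q n)) h sequentially" for q
  proof (rule metric_LIMSEQ_I)
    fix e :: real assume "e > 0"
    then have "e / 2 > 0" by simp
    have "\<forall>\<^sub>F m in sequentially. norm (poly_op (p m) A - B) < e / 2"
      using tendstoD[OF B \<open>e / 2 > 0\<close>] by (simp add: dist_norm)
    then have "\<forall>\<^sub>F m in sequentially. norm (poly_op (p m) A - B) < e / 2 \<and>
        (\<forall>\<^sub>F n in sequentially. norm (poly_op (p m) A - poly_op (q n) A) < e / 2)"
      using eventually_norm_poly_op_diff_le[OF sym p q \<open>e / 2 > 0\<close>] by (rule eventually_conj)
    then obtain m where m: "norm (poly_op (p m) A - B) < e / 2"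
      and "\<forall>\<^sub>F n in sequentially. norm (poly_op (p m) A - poly_op (q n) A) < e / 2"
      unfolding eventually_sequentially by blast
    then obtain N where "\<And>n. n \<ge> N \<Longrightarrow> norm (poly_op (p m) A - poly_op (q n) A) < e / 2"
      unfolding eventually_sequentially by blast
    with m show "\<exists>N. \<forall>n\<ge>N. dist (poly_op (q n) A) B < e"
      using dist_triangle_half_r[of "poly_op (p m) A" _ e B] by (simp add: dist_norm) blast
  qed
  have "cfc h A = B"
    unfolding cfc_def using lim LIMSEQ_unique[OF B] p by (intro the_equality) blast+
  moreover have "real_spectrum A \<subseteq> {0..M}"
    using spec \<open>norm A \<le> M\<close> by force
  ultimately show ?thesis
    using lim uniform_limit_on_subset[OF q] by blast
qed

lemma cfc_approximation:
  fixes h :: "real \<Rightarrow> real"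
  assumes h: "continuous_on {0..} h"
  obtains p where "uniform_limit {0..M} (\<lambda>n. poly (p n)) h sequentially"
    and "\<And>A :: 'a::chilbert_space \<Rightarrow>\<^sub>L 'a. positive_op A \<Longrightarrow> norm A \<le> M \<Longrightarrow>
      (\<lambda>n. poly_op (p n) A) \<longlonglongrightarrow> cfc h A"
proof -
  have "continuous_on {0..M} h"
    by (rule continuous_on_subset[OF h]) auto
  then obtain p where "uniform_limit {0..M} (\<lambda>n. poly (p n)) h sequentially"
    by (rule real_poly_uniform_approximation)
  with that cfc_tendsto[OF _ h _ this] show ?thesis by blast
qed

text \<open>The spectrum lies in \<open>[0, \<infinity>)\<close>, so the values there determine \<open>h(A)\<close>.\<close>

lemma cfc_cong:
  fixes A :: "'a::chilbert_space \<Rightarrow>\<^sub>L 'a"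
  assumes A: "positive_op A" and h: "continuous_on {0..} h"
    and eq: "\<And>t. t \<ge> 0 \<Longrightarrow> h t = k t"
  shows "cfc h A = cfc k A"
proof -
  have "continuous_on {0..} k"
    using h by (rule continuous_on_cong[THEN iffD1, rotated 2]) (auto simp: eq)
  then have "(\<lambda>n. poly_op (p n) A) \<longlonglongrightarrow> cfc k A"
    if "uniform_limit {0..norm A} (\<lambda>n. poly (p n)) k sequentially" for p
    using A that by (intro cfc_tendsto[of A k "norm A"]) auto
  moreover obtain p where p: "uniform_limit {0..norm A} (\<lambda>n. poly (p n)) h sequentially"
    and lim: "(\<lambda>n. poly_op (p n) A) \<longlonglongrightarrow> cfc h A"
    using cfc_approximation[OF h] A by blast
  moreover have "uniform_limit {0..norm A} (\<lambda>n. poly (p n)) k sequentially"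
    using p by (rule uniform_limit_cong'[THEN iffD1, rotated 2]) (auto simp: eq)
  ultimately show ?thesis
    using LIMSEQ_unique by blast
qed

lemma cfc_poly:
  fixes A :: "'a::chilbert_space \<Rightarrow>\<^sub>L 'a"
  assumes "positive_op A"
  shows "cfc (poly p) A = poly_op p A"
proof -
  have "(\<lambda>n. poly_op p A) \<longlonglongrightarrow> cfc (poly p) A"
    by (rule cfc_tendsto[OF assms, where M = "norm A"]) (auto intro: continuous_intros uniform_limit_const)
  then show ?thesis
    by (simp add: LIMSEQ_const_iff)
qed

lemma cfc_ident: "positive_op A \<Longrightarrow> cfc (\<lambda>t. t) A = A"
  for A :: "'a::chilbert_space \<Rightarrow>\<^sub>L 'a"
proof -
  assume A: "positive_op A"
  have "poly [:0, 1:] = (\<lambda>t :: real. t)" by (simp add: fun_eq_iff)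
  moreover have "poly_op [:0, 1:] A = A" by (rule blinfun_eqI) (simp add: blinfun.bilinear_simps)
  ultimately show ?thesis using cfc_poly[OF A, of "[:0, 1:]"] by simp
qed

lemma cfc_const: "positive_op A \<Longrightarrow> cfc (\<lambda>t. c) A = c *\<^sub>R id_blinfun"
  for A :: "'a::chilbert_space \<Rightarrow>\<^sub>L 'a"
proof -
  assume A: "positive_op A"
  have "poly [:c:] = (\<lambda>t. c)" by (simp add: fun_eq_iff)
  with cfc_poly[OF A, of "[:c:]"] show ?thesis by simp
qed

lemma cfc_add:
  fixes A :: "'a::chilbert_space \<Rightarrow>\<^sub>L 'a"
  assumes A: "positive_op A" and h: "continuous_on {0..} h" and k: "continuous_on {0..} k"
  shows "cfc (\<lambda>t. h t + k t) A = cfc h A + cfc k A"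
proof -
  obtain p where p: "uniform_limit {0..norm A} (\<lambda>n. poly (p n)) h sequentially"
      "(\<lambda>n. poly_op (p n) A) \<longlonglongrightarrow> cfc h A"
    using cfc_approximation[OF h] A by blast
  obtain q where q: "uniform_limit {0..norm A} (\<lambda>n. poly (q n)) k sequentially"
      "(\<lambda>n. poly_op (q n) A) \<longlonglongrightarrow> cfc k A"
    using cfc_approximation[OF k] A by blast
  have poly_add_eq: "(\<lambda>n. poly (p n + q n)) = (\<lambda>n t. poly (p n) t + poly (q n) t)"
    by (simp add: fun_eq_iff)
  have "(\<lambda>n. poly_op (p n + q n) A) \<longlonglongrightarrow> cfc (\<lambda>t. h t + k t) A"
  proof (rule cfc_tendsto[OF A])
    show "uniform_limit {0..norm A} (\<lambda>n. poly (p n + q n)) (\<lambda>t. h t + k t) sequentially"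
      unfolding poly_add_eq by (rule uniform_limit_add[OF p(1) q(1)])
  qed (auto intro!: continuous_intros h k)
  moreover have "(\<lambda>n. poly_op (p n + q n) A) \<longlonglongrightarrow> cfc h A + cfc k A"
    unfolding poly_op_add by (intro tendsto_add p q)
  ultimately show ?thesis
    by (rule LIMSEQ_unique)
qed

lemma bounded_image_continuous_Icc:
  fixes h :: "real \<Rightarrow> real"
  assumes "continuous_on {0..} h"
  shows "bounded (h ` {0..M})"
proof (intro compact_imp_bounded compact_continuous_image compact_Icc)
  show "continuous_on {0..M} h"
    by (rule continuous_on_subset[OF assms]) auto
qed

lemma cfc_mult:
  fixes A :: "'a::chilbert_space \<Rightarrow>\<^sub>L 'a"
  assumes A: "positive_op A" and h: "continuous_on {0..} h" and k: "continuous_on {0..} k"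
  shows "cfc (\<lambda>t. h t * k t) A = cfc h A o\<^sub>L cfc k A"
proof -
  obtain p where p: "uniform_limit {0..norm A} (\<lambda>n. poly (p n)) h sequentially"
      "(\<lambda>n. poly_op (p n) A) \<longlonglongrightarrow> cfc h A"
    using cfc_approximation[OF h] A by blast
  obtain q where q: "uniform_limit {0..norm A} (\<lambda>n. poly (q n)) k sequentially"
      "(\<lambda>n. poly_op (q n) A) \<longlonglongrightarrow> cfc k A"
    using cfc_approximation[OF k] A by blast
  have poly_mult_eq: "(\<lambda>n. poly (p n * q n)) = (\<lambda>n t. poly (p n) t * poly (q n) t)"
    by (simp add: fun_eq_iff)
  have "(\<lambda>n. poly_op (p n * q n) A) \<longlonglongrightarrow> cfc (\<lambda>t. h t * k t) A"
  proof (rule cfc_tendsto[OF A])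
    show "uniform_limit {0..norm A} (\<lambda>n. poly (p n * q n)) (\<lambda>t. h t * k t) sequentially"
      unfolding poly_mult_eq
      by (intro uniform_lim_mult p q bounded_image_continuous_Icc h k)
  qed (auto intro!: continuous_intros h k)
  moreover have "(\<lambda>n. poly_op (p n * q n) A) \<longlonglongrightarrow> (cfc h A o\<^sub>L cfc k A)"
    unfolding poly_op_mult
    by (rule bounded_bilinear.tendsto[OF bounded_bilinear_blinfun_compose p(2) q(2)])
  ultimately show ?thesis
    by (rule LIMSEQ_unique)
qed

lemma symmetric_op_cfc:
  fixes A :: "'a::chilbert_space \<Rightarrow>\<^sub>L 'a"
  assumes A: "positive_op A" and h: "continuous_on {0..} h"
  shows "symmetric_op (cfc h A)"
proof -
  obtain p where p: "(\<lambda>n. poly_op (p n) A) \<longlonglongrightarrow> cfc h A"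
    using cfc_approximation[OF h, of "norm A"] A by blast
  have "inner (cfc h A x) y = inner x (cfc h A y)" for x y
  proof (rule LIMSEQ_unique)
    show "(\<lambda>n. inner (poly_op (p n) A x) y) \<longlonglongrightarrow> inner (cfc h A x) y"
      by (intro tendsto_intros p)
    show "(\<lambda>n. inner (poly_op (p n) A x) y) \<longlonglongrightarrow> inner x (cfc h A y)"
      unfolding symmetric_opD[OF symmetric_op_poly_op[OF positive_op_symmetric[OF A]]]
      by (intro tendsto_intros p)
  qed
  then show ?thesis
    by (simp add: symmetric_op_def)
qed

lemma clinear_op_cfc:
  fixes A :: "'a::chilbert_space \<Rightarrow>\<^sub>L 'a"
  assumes A: "positive_op A" and h: "continuous_on {0..} h"
  shows "clinear_op (cfc h A)"
proof -
  obtain p where p: "(\<lambda>n. poly_op (p n) A) \<longlonglongrightarrow> cfc h A"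
    using cfc_approximation[OF h, of "norm A"] A by blast
  have "cfc h A (c *\<^sub>C x) = c *\<^sub>C cfc h A x" for c x
  proof (rule LIMSEQ_unique)
    show "(\<lambda>n. poly_op (p n) A (c *\<^sub>C x)) \<longlonglongrightarrow> cfc h A (c *\<^sub>C x)"
      by (intro tendsto_intros p)
    have "(\<lambda>n. scalar_op c (poly_op (p n) A x)) \<longlonglongrightarrow> scalar_op c (cfc h A x)"
      by (intro tendsto_intros p)
    then show "(\<lambda>n. poly_op (p n) A (c *\<^sub>C x)) \<longlonglongrightarrow> c *\<^sub>C cfc h A x"
      by (simp add: scalar_op.rep_eq clinear_opD[OF clinear_op_poly_op[OF positive_op_clinear[OF A]]])
  qed
  then show ?thesis
    by (simp add: clinear_op_def)
qed

lemma norm_cfc_square: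
  fixes A :: "'a::chilbert_space \<Rightarrow>\<^sub>L 'a"
  assumes "positive_op A" and "continuous_on {0..} h"
  shows "(norm (cfc h A x))\<^sup>2 = inner (cfc (\<lambda>t. h t * h t) A x) x"
  using symmetric_opD[OF symmetric_op_cfc[OF assms], of "cfc h A x" x]
  by (simp add: cfc_mult[OF assms assms(2)] power2_norm_eq_inner)

text \<open>\<open>h(A)\<close> is the square of the symmetric operator \<open>(\<surd>h)(A)\<close>.\<close>

lemma inner_cfc_nonneg:
  fixes A :: "'a::chilbert_space \<Rightarrow>\<^sub>L 'a"
  assumes A: "positive_op A" and h: "continuous_on {0..} h" and "\<And>t. t \<ge> 0 \<Longrightarrow> 0 \<le> h t"
  shows "0 \<le> inner (cfc h A x) x"
proof -
  have root: "continuous_on {0..} (\<lambda>t. sqrt (h t))"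
    by (intro continuous_intros h)
  have "cfc h A = cfc (\<lambda>t. sqrt (h t) * sqrt (h t)) A"
    by (rule cfc_cong[OF A h]) (simp add: assms(3))
  then show ?thesis
    using norm_cfc_square[OF A root, of x] by (metis zero_le_power2)
qed

lemma positive_op_cfc:
  fixes A :: "'a::chilbert_space \<Rightarrow>\<^sub>L 'a"
  assumes "positive_op A" and "continuous_on {0..} h" and "\<And>t. t \<ge> 0 \<Longrightarrow> 0 \<le> h t"
  shows "positive_op (cfc h A)"
  by (rule positive_opI) (use assms in \<open>auto intro: clinear_op_cfc symmetric_op_cfc inner_cfc_nonneg\<close>)

lemma inner_cfc_mono:
  fixes A :: "'a::chilbert_space \<Rightarrow>\<^sub>L 'a"
  assumes A: "positive_op A" and h: "continuous_on {0..} h" and k: "continuous_on {0..} k"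
    and le: "\<And>t. t \<ge> 0 \<Longrightarrow> h t \<le> k t"
  shows "inner (cfc h A x) x \<le> inner (cfc k A x) x"
proof -
  have d: "continuous_on {0..} (\<lambda>t. k t - h t)"
    by (intro continuous_intros h k)
  have "cfc (\<lambda>t. h t + (k t - h t)) A = cfc h A + cfc (\<lambda>t. k t - h t) A"
    by (rule cfc_add[OF A h d])
  with inner_cfc_nonneg[OF A d, of x] le show ?thesis
    by (simp add: blinfun.bilinear_simps inner_simps)
qed

lemma norm_cfc_mono:
  fixes A :: "'a::chilbert_space \<Rightarrow>\<^sub>L 'a"
  assumes A: "positive_op A" and h: "continuous_on {0..} h" and k: "continuous_on {0..} k"
    and le: "\<And>t. t \<ge> 0 \<Longrightarrow> \<bar>h t\<bar> \<le> k t"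
  shows "norm (cfc h A x) \<le> norm (cfc k A x)"
proof (rule power2_le_imp_le)
  have "inner (cfc (\<lambda>t. h t * h t) A x) x \<le> inner (cfc (\<lambda>t. k t * k t) A x) x"
  proof (rule inner_cfc_mono[OF A])
    fix t :: real assume "t \<ge> 0"
    then show "h t * h t \<le> k t * k t"
      using le[of t] abs_le_square_iff[of "h t" "k t"] by (simp add: power2_eq_square)
  qed (intro continuous_intros h k)+
  then show "(norm (cfc h A x))\<^sup>2 \<le> (norm (cfc k A x))\<^sup>2"
    by (simp add: norm_cfc_square A h k)
qed simp

text \<open>Intertwining passes from the operators to their polynomials, and from these to limits.\<close>

lemma cfc_intertwine:
  fixes A :: "'a::chilbert_space \<Rightarrow>\<^sub>L 'a" and B :: "'b::chilbert_space \<Rightarrow>\<^sub>L 'b"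
    and T :: "'a \<Rightarrow>\<^sub>L 'b"
  assumes A: "positive_op A" and B: "positive_op B" and h: "continuous_on {0..} h"
    and T: "T o\<^sub>L A = B o\<^sub>L T"
  shows "T o\<^sub>L cfc h A = cfc h B o\<^sub>L T"
proof -
  let ?M = "max (norm A) (norm B)"
  obtain p where p: "uniform_limit {0..?M} (\<lambda>n. poly (p n)) h sequentially"
      "(\<lambda>n. poly_op (p n) A) \<longlonglongrightarrow> cfc h A"
    using cfc_approximation[OF h, of ?M] A max.cobounded1 by metis
  have "(\<lambda>n. poly_op (p n) B) \<longlonglongrightarrow> cfc h B"
    by (rule cfc_tendsto[OF B h _ p(1)]) simp
  then have "(\<lambda>n. poly_op (p n) B o\<^sub>L T) \<longlonglongrightarrow> (cfc h B o\<^sub>L T)"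
    by (intro bounded_bilinear.tendsto[OF bounded_bilinear_blinfun_compose] tendsto_const)
  moreover have "(\<lambda>n. T o\<^sub>L poly_op (p n) A) \<longlonglongrightarrow> (T o\<^sub>L cfc h A)"
    by (intro bounded_bilinear.tendsto[OF bounded_bilinear_blinfun_compose] tendsto_const p)
  ultimately show ?thesis
    unfolding poly_op_intertwine[OF T] by (metis LIMSEQ_unique)
qed

section \<open>Square roots and absolute values\<close>

text \<open>If \<open>p\<^sub>n(t) \<rightarrow> \<surd>t\<close> uniformly, then \<open>p\<^sub>n(t\<^sup>2) \<rightarrow> t\<close> uniformly for \<open>t \<ge> 0\<close>; hence \<open>p\<^sub>n(A) = p\<^sub>n(S\<^sup>2)\<close>
  tends both to \<open>\<surd>A\<close> and to \<open>S\<close>.\<close>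

lemma square_root_eq_cfc:
  fixes S :: "'a::chilbert_space \<Rightarrow>\<^sub>L 'a"
  assumes S: "positive_op S" and A: "positive_op A" and SS: "S o\<^sub>L S = A"
  shows "S = cfc sqrt A"
proof -
  define M where "M = max (norm A) ((norm S)\<^sup>2)"
  have root: "continuous_on {0..} sqrt" by (intro continuous_intros)
  obtain p where p: "uniform_limit {0..M} (\<lambda>n. poly (p n)) sqrt sequentially"
    and lim: "(\<lambda>n. poly_op (p n) A) \<longlonglongrightarrow> cfc sqrt A"
    using cfc_approximation[OF root, of M] A by (metis M_def max.cobounded1)
  have "(\<lambda>n. poly_op (p n \<circ>\<^sub>p [:0, 0, 1:]) S) \<longlonglongrightarrow> cfc (\<lambda>t. t) S"
  proof (rule cfc_tendsto[OF S])
    show "uniform_limit {0..norm S} (\<lambda>n. poly (p n \<circ>\<^sub>p [:0, 0, 1:])) (\<lambda>t. t) sequentially"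
    proof (rule uniform_limitI)
      fix e :: real assume "e > 0"
      from uniform_limitD[OF p this]
      show "\<forall>\<^sub>F n in sequentially. \<forall>t\<in>{0..norm S}. dist (poly (p n \<circ>\<^sub>p [:0, 0, 1:]) t) t < e"
      proof (elim eventually_mono, intro ballI)
        fix n t assume *: "\<forall>t\<in>{0..M}. dist (poly (p n) t) (sqrt t) < e" and t: "t \<in> {0..norm S}"
        then have "t * t \<in> {0..M}"
          by (auto simp: M_def power2_eq_square mult_mono le_max_iff_disj)
        with * have "dist (poly (p n) (t * t)) (sqrt (t * t)) < e" by blast
        then show "dist (poly (p n \<circ>\<^sub>p [:0, 0, 1:]) t) t < e"
          using t by (simp add: poly_pcompose)
      qed
    qed
  qed (auto intro: continuous_intros)
  then show ?thesis
    using lim by (simp add: poly_op_pcompose_square SS cfc_ident[OF S] LIMSEQ_unique)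
qed

lemma sqrt_op_eq_cfc:
  fixes A :: "'a::chilbert_space \<Rightarrow>\<^sub>L 'a"
  assumes A: "positive_op A"
  shows "sqrt_op A = cfc sqrt A" "positive_op (sqrt_op A)" "sqrt_op A o\<^sub>L sqrt_op A = A"
proof -
  have root: "continuous_on {0..} sqrt" by (intro continuous_intros)
  have sq: "cfc sqrt A o\<^sub>L cfc sqrt A = A"
  proof -
    have "cfc sqrt A o\<^sub>L cfc sqrt A = cfc (\<lambda>t. sqrt t * sqrt t) A"
      by (rule cfc_mult[OF A root root, symmetric])
    also have "\<dots> = cfc (\<lambda>t. t) A"
      by (rule cfc_cong[OF A]) (auto intro!: continuous_intros)
    finally show ?thesis by (simp add: cfc_ident A)
  qed
  have pos: "positive_op (cfc sqrt A)"
    by (rule positive_op_cfc[OF A root]) simp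
  show *: "sqrt_op A = cfc sqrt A"
    unfolding sqrt_op_def
    by (rule the_equality) (use sq pos square_root_eq_cfc[OF _ A] in blast)+
  show "positive_op (sqrt_op A)" "sqrt_op A o\<^sub>L sqrt_op A = A"
    using * pos sq by simp_all
qed

lemma positive_op_abs_op:
  fixes T :: "'a::chilbert_space \<Rightarrow>\<^sub>L 'b::chilbert_space"
  assumes "clinear_op T"
  shows "positive_op (abs_op T)"
  unfolding abs_op_def by (intro sqrt_op_eq_cfc(2) positive_op_cadjoint_compose assms)

lemma norm_abs_op:
  fixes T :: "'a::chilbert_space \<Rightarrow>\<^sub>L 'b::chilbert_space"
  assumes T: "clinear_op T"
  shows "norm (abs_op T x) = norm (T x)"
proof -
  have "(norm (abs_op T x))\<^sup>2 = inner ((abs_op T o\<^sub>L abs_op T) x) x"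
    using symmetric_opD[OF positive_op_symmetric[OF positive_op_abs_op[OF T]]]
    by (simp add: power2_norm_eq_inner)
  also have "abs_op T o\<^sub>L abs_op T = cadjoint T o\<^sub>L T"
    unfolding abs_op_def by (intro sqrt_op_eq_cfc(3) positive_op_cadjoint_compose T)
  also have "inner ((cadjoint T o\<^sub>L T) x) x = (norm (T x))\<^sup>2"
    using inner_cadjoint[OF T, of x "T x"] by (simp add: power2_norm_eq_inner inner_commute)
  finally show ?thesis by (simp add: power2_eq_iff_nonneg)
qed

text \<open>From \<open>T (T\<^sup>* T) = (T T\<^sup>*) T\<close> by applying the calculus twice, first with the square root. It
  replaces the polar decomposition in the proof of the mixed Schwarz inequality.\<close>

lemma cfc_abs_op_intertwine:
  fixes T :: "'a::chilbert_space \<Rightarrow>\<^sub>L 'b::chilbert_space"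
  assumes T: "clinear_op T" and h: "continuous_on {0..} h"
  shows "T (cfc h (abs_op T) x) = cfc h (abs_op (cadjoint T)) (T x)"
proof -
  note T' = clinear_op_cadjoint[OF T]
  let ?A = "cadjoint T o\<^sub>L T" and ?B = "cadjoint (cadjoint T) o\<^sub>L cadjoint T"
  have A: "positive_op ?A" and B: "positive_op ?B"
    using T T' by (auto intro: positive_op_cadjoint_compose)
  have "T o\<^sub>L ?A = ?B o\<^sub>L T"
    by (rule blinfun_eqI) (simp add: cadjoint_cadjoint[OF T])
  then have "T o\<^sub>L cfc sqrt ?A = cfc sqrt ?B o\<^sub>L T"
    by (intro cfc_intertwine A B continuous_intros)
  then have "T o\<^sub>L abs_op T = abs_op (cadjoint T) o\<^sub>L T"
    by (simp add: abs_op_def sqrt_op_eq_cfc(1) A B)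
  then have "T o\<^sub>L cfc h (abs_op T) = cfc h (abs_op (cadjoint T)) o\<^sub>L T"
    using T T' by (intro cfc_intertwine positive_op_abs_op h)
  then show ?thesis
    by (metis blinfun_apply_blinfun_compose)
qed

section \<open>The mixed Schwarz inequality\<close>

text \<open>Formally \<open>\<langle>T x, y\<rangle> = \<langle>f(|T|) x, T\<^sup>* f(|T\<^sup>*|)\<^sup>-\<^sup>1 y\<rangle>\<close>, and \<open>T\<^sup>*\<close> has the same norm values as
  \<open>|T\<^sup>*|\<close>, so the second vector has the norm of \<open>g(|T\<^sup>*|) y\<close>. As \<open>f\<close> may vanish, the argument is
  run with \<open>f + \<epsilon>\<close>; this does no harm, since \<open>t / (f t + \<epsilon>) \<le> g t\<close>.\<close>

lemma mixed_schwarz: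
  fixes T :: "'a::chilbert_space \<Rightarrow>\<^sub>L 'b::chilbert_space"
  assumes T: "clinear_op T"
    and f: "continuous_on {0..} f" and g: "continuous_on {0..} g"
    and f0: "\<And>t. t \<ge> 0 \<Longrightarrow> 0 \<le> f t" and g0: "\<And>t. t \<ge> 0 \<Longrightarrow> 0 \<le> g t"
    and fg: "\<And>t. t \<ge> 0 \<Longrightarrow> f t * g t = t"
  shows "cmod (cinner (T x) y) \<le> norm (cfc f (abs_op T) x) * norm (cfc g (abs_op (cadjoint T)) y)"
proof -
  let ?P = "abs_op T" and ?Q = "abs_op (cadjoint T)"
  have P: "positive_op ?P" and Q: "positive_op ?Q"
    using T clinear_op_cadjoint[OF T] by (auto intro: positive_op_abs_op)
  have bound: "cmod (cinner (T x) y) \<le> (norm (cfc f ?P x) + \<epsilon> * norm x) * norm (cfc g ?Q y)"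
    if e: "\<epsilon> > 0" for \<epsilon> :: real
  proof -
    define h where "h t = f t + \<epsilon>" for t
    define k where "k t = inverse (f t + \<epsilon>)" for t
    have pos: "f t + \<epsilon> > 0" if "t \<ge> 0" for t
      using f0[OF that] e by simp
    have h: "continuous_on {0..} h"
      unfolding h_def by (intro continuous_intros f)
    have k: "continuous_on {0..} k"
      unfolding k_def using pos by (intro continuous_intros f) fastforce
    have "cfc (\<lambda>t. k t * h t) ?P = cfc (\<lambda>t. 1) ?P"
    proof (rule cfc_cong[OF P])
      show "k t * h t = 1" if "t \<ge> 0" for t
        using pos[OF that] by (simp add: k_def h_def)
    qed (intro continuous_intros h k)
    then have "cfc k ?P o\<^sub>L cfc h ?P = id_blinfun"
      by (simp add: cfc_mult[OF P k h] cfc_const[OF P])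
    then have "x = cfc k ?P (cfc h ?P x)"
      by (metis blinfun_apply_blinfun_compose blinfun_apply_id_blinfun id_apply)
    then have "cinner (T x) y = cinner (cfc k ?Q (T (cfc h ?P x))) y"
      by (metis cfc_abs_op_intertwine[OF T k])
    (* k(Q) is symmetric and moves to the right-hand argument, followed by T as its adjoint *)
    also have "\<dots> = cinner (cfc h ?P x) (cadjoint T (cfc k ?Q y))"
      by (simp add: cinner_symmetric_op symmetric_op_cfc clinear_op_cfc Q k cinner_cadjoint[OF T])
    finally have "cmod (cinner (T x) y) \<le> norm (cfc h ?P x) * norm (cadjoint T (cfc k ?Q y))"
      using cmod_cinner_le by metis
    also have "\<dots> \<le> (norm (cfc f ?P x) + \<epsilon> * norm x) * norm (cfc g ?Q y)"
    proof (rule mult_mono)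
      have "cfc h ?P = cfc f ?P + \<epsilon> *\<^sub>R id_blinfun"
        unfolding h_def by (simp add: cfc_add P f cfc_const)
      then show "norm (cfc h ?P x) \<le> norm (cfc f ?P x) + \<epsilon> * norm x"
        using norm_triangle_ineq[of "cfc f ?P x" "\<epsilon> *\<^sub>R x"] e by (simp add: blinfun.bilinear_simps)
      have "norm (cadjoint T (cfc k ?Q y)) = norm (?Q (cfc k ?Q y))"
        by (simp add: norm_abs_op clinear_op_cadjoint T)
      also have "\<dots> = norm (cfc (\<lambda>t. t * k t) ?Q y)"
        by (simp add: cfc_mult Q k cfc_ident)
      also have "\<dots> \<le> norm (cfc g ?Q y)"
      proof (rule norm_cfc_mono[OF Q _ g])
        fix t :: real assume t: "t \<ge> 0"
        have "t \<le> g t * (f t + \<epsilon>)"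
          using fg[OF t] g0[OF t] e by (simp add: algebra_simps)
        then show "\<bar>t * k t\<bar> \<le> g t"
          using pos[OF t] t by (simp add: k_def field_simps)
      qed (intro continuous_intros k)
      finally show "norm (cadjoint T (cfc k ?Q y)) \<le> norm (cfc g ?Q y)" .
    qed (use e in auto)
    finally show ?thesis .
  qed
  have "cmod (cinner (T x) y) \<le> (norm (cfc f ?P x) + 0 * norm x) * norm (cfc g ?Q y)"
  proof (rule tendsto_lowerbound)
    show "((\<lambda>\<epsilon>. (norm (cfc f ?P x) + \<epsilon> * norm x) * norm (cfc g ?Q y)) \<longlongrightarrow>
        (norm (cfc f ?P x) + 0 * norm x) * norm (cfc g ?Q y)) (at_right 0)"
      by (intro tendsto_intros)
    show "\<forall>\<^sub>F \<epsilon> in at_right 0. cmod (cinner (T x) y) \<le> (norm (cfc f ?P x) + \<epsilon> * norm x) * norm (cfc g ?Q y)"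
      using bound by (auto simp: eventually_at_right_field intro: exI[of _ 1])
  qed simp
  then show ?thesis by simp
qed

section \<open>The Hoelder--McCarthy inequality\<close>

lemma powr_above_tangent:
  fixes s t r :: real
  assumes "s > 0" "t \<ge> 0" "r \<ge> 1"
  shows "s powr r + r * s powr (r - 1) * (t - s) \<le> t powr r"
proof (cases "t = 0")
  case True
  have "s powr r = s powr (r - 1) * s"
    using \<open>s > 0\<close> by (simp add: powr_diff)
  with True assms show ?thesis by (simp add: algebra_simps)
next
  case False
  have "(\<lambda>t. t powr r) t - (\<lambda>t. t powr r) s \<ge> (r * s powr (r - 1)) * (t - s)"
  proof (rule convex_on_imp_above_tangent[OF powr_convex[OF \<open>r \<ge> 1\<close>]])
    show "((\<lambda>t. t powr r) has_real_derivative r * s powr (r - 1)) (at s within {0<..})"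
      using \<open>s > 0\<close> by (auto intro!: derivative_eq_intros)
  qed (use assms False in \<open>auto simp: interior_open\<close>)
  then show ?thesis by simp
qed

text \<open>The sum of the tangent inequalities for \<open>a\<close> and \<open>b\<close> at their mean; the linear terms cancel.\<close>

lemma power_mean_two:
  fixes a b r :: real
  assumes "a \<ge> 0" "b \<ge> 0" "r \<ge> 1"
  shows "(a + b) powr r \<le> 2 powr (r - 1) * (a powr r + b powr r)"
proof (cases "a + b = 0")
  case False
  define s where "s = (a + b) / 2"
  have s: "s > 0" using assms False by (simp add: s_def)
  have "s powr r + r * s powr (r - 1) * (a - s) \<le> a powr r"
    "s powr r + r * s powr (r - 1) * (b - s) \<le> b powr r"
    using powr_above_tangent s assms by auto
  moreover have "b - s = - (a - s)" by (simp add: s_def field_simps)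
  ultimately have mean: "2 * s powr r \<le> a powr r + b powr r" by (simp add: algebra_simps)
  have "2 * s = a + b" by (simp add: s_def)
  then have "(a + b) powr r = 2 powr (r - 1) * (2 * s powr r)"
    using s by (simp add: powr_mult powr_diff flip: \<open>2 * s = a + b\<close>)
  with mean show ?thesis by simp
qed (use assms in auto)

text \<open>Apply the functional calculus to the tangent of \<open>t\<^sup>r\<close> at the mean value
  \<open>\<langle>h(A) x, x\<rangle> / \<parallel>x\<parallel>\<^sup>2\<close>: the linear term has mean zero.\<close>

lemma hoelder_mccarthy:
  fixes A :: "'a::chilbert_space \<Rightarrow>\<^sub>L 'a"
  assumes A: "positive_op A" and h: "continuous_on {0..} h"
    and h0: "\<And>t. t \<ge> 0 \<Longrightarrow> 0 \<le> h t" and r: "r \<ge> 1"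
  shows "inner (cfc h A x) x powr r \<le>
    ((norm x)\<^sup>2) powr (r - 1) * inner (cfc (\<lambda>t. h t powr r) A x) x"
proof -
  have hr: "continuous_on {0..} (\<lambda>t. h t powr r)"
    using h h0 r by (intro continuous_on_powr') (auto intro: continuous_intros)
  define a where "a = inner (cfc h A x) x"
  define n where "n = (norm x)\<^sup>2"
  let ?R = "inner (cfc (\<lambda>t. h t powr r) A x) x"
  have R0: "0 \<le> ?R"
    by (rule inner_cfc_nonneg[OF A hr]) simp
  have a0: "0 \<le> a"
    unfolding a_def by (rule inner_cfc_nonneg[OF A h h0])
  show ?thesis
  proof (cases "a = 0")
    case True
    with R0 r show ?thesis by (simp add: a_def)
  next
    case False
    then have "x \<noteq> 0" by (auto simp: a_def)
    then have n: "n > 0" by (simp add: n_def)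
    define s where "s = a / n"
    have s: "s > 0" using False a0 n by (simp add: s_def)
    define d where "d = r * s powr (r - 1)"
    define c where "c = s powr r - d * s"
    (* d * h t is read as the product of a constant function with h *)
    have "cfc (\<lambda>t. c + d * h t) A = c *\<^sub>R id_blinfun + (d *\<^sub>R id_blinfun o\<^sub>L cfc h A)"
      by (simp add: cfc_add cfc_mult cfc_const A h continuous_on_mult_left)
    then have "inner (cfc (\<lambda>t. c + d * h t) A x) x = c * n + d * a"
      by (simp add: a_def n_def blinfun.bilinear_simps inner_simps power2_norm_eq_inner)
    also have "\<dots> = s powr r * n"
      using n by (simp add: c_def s_def algebra_simps)
    finally have "s powr r * n = inner (cfc (\<lambda>t. c + d * h t) A x) x" ..
    also have "\<dots> \<le> ?R"
    proof (rule inner_cfc_mono[OF A _ hr])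
      show "c + d * h t \<le> h t powr r" if "t \<ge> 0" for t
        using powr_above_tangent[OF s h0[OF that] r] by (simp add: c_def d_def algebra_simps)
    qed (intro continuous_intros h)
    finally have "n powr (r - 1) * (s powr r * n) \<le> n powr (r - 1) * ?R"
      by (intro mult_left_mono) auto
    moreover have "n powr (r - 1) * (s powr r * n) = a powr r"
      using n a0 by (simp add: s_def powr_divide powr_diff)
    ultimately show ?thesis by (simp add: a_def n_def)
  qed
qed

lemma norm_cfc_powr_le:
  fixes A :: "'a::chilbert_space \<Rightarrow>\<^sub>L 'a"
  assumes A: "positive_op A" and f: "continuous_on {0..} f"
    and f0: "\<And>t. t \<ge> 0 \<Longrightarrow> 0 \<le> f t" and r: "r \<ge> 1"
  shows "norm (cfc f A x) powr r \<le>
    norm x powr (r - 1) * sqrt (inner (cfc (\<lambda>t. f t powr (2 * r)) A x) x)"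
proof -
  have square: "u\<^sup>2 powr w = (u powr w)\<^sup>2" if "u \<ge> 0" for u w :: real
    using powr_mult[of u u w] that by (simp add: power2_eq_square)
  have ff: "continuous_on {0..} (\<lambda>t. f t * f t)"
    by (intro continuous_intros f)
  have "cfc (\<lambda>t. (f t * f t) powr r) A = cfc (\<lambda>t. f t powr (2 * r)) A"
  proof (rule cfc_cong[OF A])
    show "continuous_on {0..} (\<lambda>t. (f t * f t) powr r)"
      using ff r by (intro continuous_on_powr') (auto intro: continuous_intros)
    show "(f t * f t) powr r = f t powr (2 * r)" if "t \<ge> 0" for t
      using f0[OF that] by (simp add: powr_mult powr_add[symmetric])
  qed
  then have "(norm (cfc f A x))\<^sup>2 powr r \<le> (norm x)\<^sup>2 powr (r - 1) * inner (cfc (\<lambda>t. f t powr (2 * r)) A x) x"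
    using hoelder_mccarthy[OF A ff _ r, of x] by (simp add: norm_cfc_square[OF A f])
  then have "(norm (cfc f A x) powr r)\<^sup>2 \<le> (norm x powr (r - 1))\<^sup>2 * inner (cfc (\<lambda>t. f t powr (2 * r)) A x) x"
    by (simp add: square)
  from real_sqrt_le_mono[OF this] show ?thesis
    by (simp add: real_sqrt_mult)
qed

lemma cinner_powr_le:
  fixes T :: "'a::chilbert_space \<Rightarrow>\<^sub>L 'b::chilbert_space"
  assumes T: "clinear_op T" and r: "r \<ge> 1"
    and f: "continuous_on {0..} f" and g: "continuous_on {0..} g"
    and f0: "\<And>t. t \<ge> 0 \<Longrightarrow> 0 \<le> f t" and g0: "\<And>t. t \<ge> 0 \<Longrightarrow> 0 \<le> g t"
    and fg: "\<And>t. t \<ge> 0 \<Longrightarrow> f t * g t = t"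
  shows "cmod (cinner (T x) y) powr r \<le> (norm x * norm y) powr (r - 1) *
    (sqrt (inner (cfc (\<lambda>t. f t powr (2 * r)) (abs_op T) x) x) *
     sqrt (inner (cfc (\<lambda>t. g t powr (2 * r)) (abs_op (cadjoint T)) y) y))"
proof -
  have P: "positive_op (abs_op T)" and Q: "positive_op (abs_op (cadjoint T))"
    using T clinear_op_cadjoint[OF T] by (auto intro: positive_op_abs_op)
  have "cmod (cinner (T x) y) powr r \<le>
      (norm (cfc f (abs_op T) x) * norm (cfc g (abs_op (cadjoint T)) y)) powr r"
    using mixed_schwarz[OF T f g f0 g0 fg] r by (intro powr_mono2) auto
  also have "\<dots> = norm (cfc f (abs_op T) x) powr r * norm (cfc g (abs_op (cadjoint T)) y) powr r"
    by (simp add: powr_mult)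
  also have "\<dots> \<le> (norm x powr (r - 1) * sqrt (inner (cfc (\<lambda>t. f t powr (2 * r)) (abs_op T) x) x)) *
      (norm y powr (r - 1) * sqrt (inner (cfc (\<lambda>t. g t powr (2 * r)) (abs_op (cadjoint T)) y) y))"
    by (intro mult_mono norm_cfc_powr_le[OF P f f0 r] norm_cfc_powr_le[OF Q g g0 r])
      (auto intro!: order_trans[OF _ norm_cfc_powr_le[OF P f f0 r]])
  finally show ?thesis
    by (simp add: powr_mult mult_ac)
qed

section \<open>The numerical radius of an off-diagonal operator matrix\<close>

lemma numerical_radius_powr_le:
  fixes T :: "'a::complex_inner \<Rightarrow>\<^sub>L 'a"
  assumes r: "r > 0" and "0 \<le> c"
    and le: "\<And>x. norm x = 1 \<Longrightarrow> cmod (cinner (T x) x) powr r \<le> c"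
  shows "numerical_radius T powr r \<le> c"
proof -
  let ?S = "insert 0 {cmod (cinner (T x) x) |x. norm x = 1}"
  have root: "u \<le> c powr (1 / r)" if "u \<ge> 0" "u powr r \<le> c" for u
    using powr_mono2[of "1 / r" "u powr r" c] that r by (simp add: powr_powr)
  have upper: "u \<le> c powr (1 / r)" if "u \<in> ?S" for u
    using that le root by auto
  have "numerical_radius T \<le> c powr (1 / r)"
    unfolding numerical_radius_def using upper by (intro cSup_least) auto
  moreover have "0 \<le> numerical_radius T"
    unfolding numerical_radius_def
    by (rule cSup_upper) (use upper in \<open>auto intro!: bdd_aboveI[of _ "c powr (1 / r)"]\<close>)
  ultimately have "numerical_radius T powr r \<le> (c powr (1 / r)) powr r"
    using r by (intro powr_mono2) auto
  then show ?thesis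
    using assms by (simp add: powr_powr)
qed

lemma cauchy_schwarz_sqrt_two:
  fixes a b c d :: real
  assumes "a \<ge> 0" "b \<ge> 0" "c \<ge> 0" "d \<ge> 0"
  shows "sqrt a * sqrt b + sqrt c * sqrt d \<le> sqrt (a + d) * sqrt (b + c)"
proof (rule power2_le_imp_le)
  have "0 \<le> (sqrt a * sqrt c - sqrt b * sqrt d)\<^sup>2" by simp
  also have "\<dots> = a * c + b * d - 2 * (sqrt a * sqrt b * sqrt c * sqrt d)"
    using assms by (simp add: power2_diff power_mult_distrib)
  finally show "(sqrt a * sqrt b + sqrt c * sqrt d)\<^sup>2 \<le> (sqrt (a + d) * sqrt (b + c))\<^sup>2"
    using assms by (simp add: power2_sum power_mult_distrib algebra_simps)
qed (use assms in simp)

lemma inner_blinfun_le: "inner (blinfun_apply N x) x \<le> norm N * (norm x)\<^sup>2"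
  for N :: "'a::real_inner \<Rightarrow>\<^sub>L 'a"
  using order_trans[OF norm_cauchy_schwarz[of "N x" x] mult_right_mono[OF norm_blinfun[of N x] norm_ge_zero[of x]]]
  by (simp add: power2_eq_square mult.assoc)

text \<open>The pairs \<open>(f1, g1)\<close> for \<open>X\<close> and \<open>(f2, g2)\<close> for \<open>Y\<close> are independent of each other, so that
  one lemma yields both inequalities of the theorem: \<open>(f, g), (f, g)\<close> and \<open>(f, g), (g, f)\<close>. The
  constant \<open>1/2\<close> is \<open>2\<^bsup>r-1\<^esup>\<close> from the power mean times \<open>2\<^bsup>-r\<^esup>\<close> from \<open>\<parallel>u\<parallel> \<parallel>v\<parallel> \<le> 1/2\<close>.\<close>

lemma numerical_radius_off_diagonal_le:
  fixes X :: "'b::chilbert_space \<Rightarrow>\<^sub>L 'a::chilbert_space"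
    and Y :: "'a \<Rightarrow>\<^sub>L 'b"
  assumes X: "clinear_op X" and Y: "clinear_op Y" and r: "r \<ge> 1"
    and cont: "continuous_on {0..} f1" "continuous_on {0..} g1"
      "continuous_on {0..} f2" "continuous_on {0..} g2"
    and nonneg: "\<And>t. t \<ge> 0 \<Longrightarrow> 0 \<le> f1 t" "\<And>t. t \<ge> 0 \<Longrightarrow> 0 \<le> g1 t"
      "\<And>t. t \<ge> 0 \<Longrightarrow> 0 \<le> f2 t" "\<And>t. t \<ge> 0 \<Longrightarrow> 0 \<le> g2 t"
    and prod: "\<And>t. t \<ge> 0 \<Longrightarrow> f1 t * g1 t = t" "\<And>t. t \<ge> 0 \<Longrightarrow> f2 t * g2 t = t"
  shows "numerical_radius (block_op 0 X Y 0) powr r \<le> 1 / 2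
    * norm (cfc (\<lambda>t. f1 t powr (2 * r)) (abs_op X)
          + cfc (\<lambda>t. g2 t powr (2 * r)) (abs_op (cadjoint Y))) powr (1 / 2)
    * norm (cfc (\<lambda>t. f2 t powr (2 * r)) (abs_op Y)
          + cfc (\<lambda>t. g1 t powr (2 * r)) (abs_op (cadjoint X))) powr (1 / 2)"
proof -
  let ?F1 = "cfc (\<lambda>t. f1 t powr (2 * r)) (abs_op X)"
  let ?G1 = "cfc (\<lambda>t. g1 t powr (2 * r)) (abs_op (cadjoint X))"
  let ?F2 = "cfc (\<lambda>t. f2 t powr (2 * r)) (abs_op Y)"
  let ?G2 = "cfc (\<lambda>t. g2 t powr (2 * r)) (abs_op (cadjoint Y))"
  have powr_cfc_nonneg: "0 \<le> inner (cfc (\<lambda>t. h t powr (2 * r)) A z) z"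
    if "positive_op A" "continuous_on {0..} h" "\<And>t. t \<ge> 0 \<Longrightarrow> 0 \<le> h t"
    for A :: "'c::chilbert_space \<Rightarrow>\<^sub>L 'c" and h z
  proof (rule inner_cfc_nonneg[OF that(1)])
    show "continuous_on {0..} (\<lambda>t. h t powr (2 * r))"
      using that r by (intro continuous_on_powr') (auto intro: continuous_intros)
  qed simp
  have bound: "cmod (cinner (block_op 0 X Y 0 z) z) powr r \<le>
      1 / 2 * sqrt (norm (?F1 + ?G2)) * sqrt (norm (?F2 + ?G1))" if z: "norm z = 1" for z
  proof -
    obtain u v where uv: "z = (u, v)" by (cases z)
    have unit: "(norm u)\<^sup>2 + (norm v)\<^sup>2 = 1"
      using z by (simp add: uv norm_Pair)
    let ?m = "norm v * norm u"
    let ?a = "cmod (cinner (X v) u)" and ?b = "cmod (cinner (Y u) v)"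
    let ?\<alpha> = "inner (?F1 v) v" and ?\<beta> = "inner (?G1 u) u"
      and ?\<gamma> = "inner (?F2 u) u" and ?\<delta> = "inner (?G2 v) v"
    have nn: "0 \<le> ?\<alpha>" "0 \<le> ?\<beta>" "0 \<le> ?\<gamma>" "0 \<le> ?\<delta>"
      using X Y clinear_op_cadjoint[OF X] clinear_op_cadjoint[OF Y] cont nonneg
      by (intro powr_cfc_nonneg positive_op_abs_op; simp)+
    have a: "?a powr r \<le> ?m powr (r - 1) * (sqrt ?\<alpha> * sqrt ?\<beta>)"
      by (rule cinner_powr_le[OF X r cont(1,2) nonneg(1,2) prod(1)])
    have b: "?b powr r \<le> ?m powr (r - 1) * (sqrt ?\<gamma> * sqrt ?\<delta>)"
      using cinner_powr_le[OF Y r cont(3,4) nonneg(3,4) prod(2), of u v] by (simp add: mult.commute)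
    have "cmod (cinner (block_op 0 X Y 0 z) z) = cmod (cinner (X v) u + cinner (Y u) v)"
      by (simp add: uv block_op_apply cinner_prod_def)
    also have "\<dots> \<le> ?a + ?b" by (rule norm_triangle_ineq)
    finally have "cmod (cinner (block_op 0 X Y 0 z) z) powr r \<le> (?a + ?b) powr r"
      using r by (intro powr_mono2) auto
    also have "\<dots> \<le> 2 powr (r - 1) * (?a powr r + ?b powr r)"
      using r by (intro power_mean_two) auto
    also have "\<dots> \<le> 2 powr (r - 1) * (?m powr (r - 1) * (sqrt ?\<alpha> * sqrt ?\<beta> + sqrt ?\<gamma> * sqrt ?\<delta>))"
      using add_mono[OF a b] by (intro mult_left_mono) (simp_all add: distrib_left)
    also have "\<dots> \<le> 2 powr (r - 1) * (?m powr (r - 1) * (sqrt (?\<alpha> + ?\<delta>) * sqrt (?\<beta> + ?\<gamma>)))"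
      using nn by (intro mult_left_mono cauchy_schwarz_sqrt_two) auto
    also have "\<dots> \<le> 2 powr (r - 1) * (?m powr (r - 1) *
        (sqrt (norm (?F1 + ?G2) * (norm v)\<^sup>2) * sqrt (norm (?F2 + ?G1) * (norm u)\<^sup>2)))"
      using inner_blinfun_le[of "?F1 + ?G2" v] inner_blinfun_le[of "?F2 + ?G1" u] nn
      by (intro mult_left_mono mult_mono real_sqrt_le_mono)
        (auto simp: blinfun.bilinear_simps inner_simps add.commute)
    also have "\<dots> = 2 powr (r - 1) * (?m powr (r - 1) * ?m) * (sqrt (norm (?F1 + ?G2)) * sqrt (norm (?F2 + ?G1)))"
      by (simp add: real_sqrt_mult)
    also have "?m powr (r - 1) * ?m = ?m powr r"
      using powr_mult_base[of ?m "r - 1"] by (simp add: mult.commute)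
    also have "2 powr (r - 1) * ?m powr r \<le> 1 / 2"
    proof -
      have "0 \<le> (norm u - norm v)\<^sup>2" by simp
      then have "?m \<le> 1 / 2"
        using unit by (simp add: power2_diff mult_ac)
      then have "?m powr r \<le> (1 / 2) powr r"
        using r by (intro powr_mono2) auto
      then have "2 powr (r - 1) * ?m powr r \<le> 2 powr (r - 1) * (1 / 2) powr r"
        by (intro mult_left_mono) auto
      also have "\<dots> = 1 / 2" by (simp add: powr_diff powr_divide)
      finally show ?thesis .
    qed
    finally show ?thesis by (simp add: mult_right_mono mult.assoc)
  qed
  have "numerical_radius (block_op 0 X Y 0) powr r \<le>
      1 / 2 * sqrt (norm (?F1 + ?G2)) * sqrt (norm (?F2 + ?G1))"
    by (rule numerical_radius_powr_le) (use r bound in auto)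
  then show ?thesis by (simp add: powr_half_sqrt)
qed

text \<open>The sharper constant \<open>1/2\<close> is weakened to \<open>2\<^bsup>r-2\<^esup>\<close>, which is at least as large for
  \<open>r \<ge> 1\<close>.\<close>

theorem theorem2p4:
  fixes X :: "'b::chilbert_space \<Rightarrow>\<^sub>L 'a::chilbert_space"
    and Y :: "'a \<Rightarrow>\<^sub>L 'b"
    and f g :: "real \<Rightarrow> real"
    and r :: real
  assumes "clinear_op X" and "clinear_op Y"
    and "r \<ge> 1"
    and "continuous_on {0..} f" and "continuous_on {0..} g"
    and "\<And>t. t \<ge> 0 \<Longrightarrow> f t \<ge> 0" and "\<And>t. t \<ge> 0 \<Longrightarrow> g t \<ge> 0"
    and "\<And>t. t \<ge> 0 \<Longrightarrow> f t * g t = t"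
  shows "numerical_radius (block_op 0 X Y 0) powr r \<le> 2 powr (r - 2)
           * norm (cfc (\<lambda>t. f t powr (2 * r)) (abs_op X)
                 + cfc (\<lambda>t. g t powr (2 * r)) (abs_op (cadjoint Y))) powr (1/2)
           * norm (cfc (\<lambda>t. f t powr (2 * r)) (abs_op Y)
                 + cfc (\<lambda>t. g t powr (2 * r)) (abs_op (cadjoint X))) powr (1/2)
       \<and> numerical_radius (block_op 0 X Y 0) powr r \<le> 2 powr (r - 2)
           * norm (cfc (\<lambda>t. f t powr (2 * r)) (abs_op X)
                 + cfc (\<lambda>t. f t powr (2 * r)) (abs_op (cadjoint Y))) powr (1/2)
           * norm (cfc (\<lambda>t. g t powr (2 * r)) (abs_op Y)
                 + cfc (\<lambda>t. g t powr (2 * r)) (abs_op (cadjoint X))) powr (1/2)"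
proof -
  have "2 powr (- 1) \<le> (2::real) powr (r - 2)"
    using \<open>r \<ge> 1\<close> by (intro powr_mono) auto
  then have half: "1 / 2 * M powr (1 / 2) * N powr (1 / 2) \<le> 2 powr (r - 2) * M powr (1 / 2) * N powr (1 / 2)"
    for M N :: real
    by (intro mult_right_mono) (auto simp: powr_minus_divide)
  have gf: "\<And>t. t \<ge> 0 \<Longrightarrow> g t * f t = t"
    using assms(8) by (simp add: mult.commute)
  show ?thesis
    by (intro conjI order_trans[OF numerical_radius_off_diagonal_le half])
      (use assms gf in auto)
qed

end
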